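(* If $D$ is an algebraic division ring and $n\ge2$ is an integer, then every matrix in $\mathrm{M}_n(D)$ can be expressed as a product of two commutators in $\mathrm{M}_n(D)$.
   Context: A division ring $D$ with center $F$ is algebraic if every $a\in D$ is algebraic over $F$, i.e. there is a nonzero one-variable polynomial $f$ with coefficients in $F$ such that $f(a)=0$. $\mathrm{M}_n(D)$ is the ring of $n\times n$ matrices over $D$. A commutator in a ring $S$ is an element $[a,b]=ab-ba$ with $a,b\in S$. *)

theory Defs
  imports "Jordan_Normal_Form.Matrix" "HOL-Computational_Algebra.Polynomial"
begin

definition ring_center :: "'a::ring_1 set" where
  "ring_center = {z. \<forall>x. z * x = x * z}"

text \<open>
  The library's \<open>poly\<close> and \<open>algebraic\<close> require commutativity, so the value \<open>f(a)\<close> is written out.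
  Since the coefficients are central, the side on which they are placed does not matter.
\<close>

definition algebraic_over_center :: "'a::ring_1 \<Rightarrow> bool" where
  "algebraic_over_center a \<longleftrightarrow>
    (\<exists>f :: 'a poly. f \<noteq> 0 \<and> (\<forall>i. coeff f i \<in> ring_center) \<and>
      (\<Sum>i\<le>degree f. coeff f i * a ^ i) = 0)"

definition commutators_mat :: "nat \<Rightarrow> 'a::ring_1 mat set" where
  "commutators_mat n = {A * B - B * A | A B. A \<in> carrier_mat n n \<and> B \<in> carrier_mat n n}"

end

theory Submission
  imports Defs
begin

text \<open>
  Let \<open>J\<close> be the matrix with ones on the superdiagonal. Over any ring, \<open>A = [J, X]\<close> can be solved
  for \<open>X\<close> as soon as the entries of \<open>A\<close> sum to zero along the main diagonal and along every diagonal
  below it, and being a commutator is invariant under similarity. So it suffices to factor some matrix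
  similar to \<open>M\<close> into two such matrices.

  Scalar and singular matrices factor directly through signed permutations and shifts. Otherwise some
  \<open>v\<close> and \<open>M v\<close> are independent, and \<open>v\<close>, \<open>M v\<close> can be taken as basis vectors. If \<open>M\<close> does not act as
  a scalar modulo \<open>v\<close>, \<open>M v\<close>, then writing \<open>M = (M V U) (U\<^sup>-\<^sup>1 W)\<close> with \<open>W = V\<^sup>-\<^sup>1\<close> fixed and \<open>U\<close> a
  unipotent matrix with free first row leaves enough freedom to annihilate all diagonal sums of the
  first factor. If it does act as a scalar, \<open>M\<close> is block triangular with a \<open>2 \<times> 2\<close> companion block and a
  scalar block, and the factorisations of the blocks are combined. Only \<open>n = 3\<close> lacks room for this: there
  an element other than \<open>0\<close> and \<open>1\<close> replaces the missing signed permutation, and the field with two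
  elements is settled by explicit factorisations.
\<close>

section \<open>Vanishing diagonal sums, commutators and similarity\<close>

text \<open>Diagonals above the main one are unconstrained, so every strictly upper triangular
  matrix qualifies. For \<open>d\<close> at least \<open>n\<close> the truncated subtraction makes
  the sum empty.\<close>

definition null_diagonals :: "nat \<Rightarrow> 'a::ring_1 mat \<Rightarrow> bool" where
  "null_diagonals n A \<longleftrightarrow> A \<in> carrier_mat n n \<and> (\<forall>d. (\<Sum>j<n - d. A $$ (j + d, j)) = 0)"

lemma commutators_matI:
  "A \<in> carrier_mat n n \<Longrightarrow> B \<in> carrier_mat n n \<Longrightarrow> A * B - B * A \<in> commutators_mat n"
  unfolding commutators_mat_def by blast

lemma commutators_mat_carrier: "C \<in> commutators_mat n \<Longrightarrow> C \<in> carrier_mat n n"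
  unfolding commutators_mat_def by auto

text \<open>Once \<open>Q * P\<close> is the identity, sending \<open>X\<close> to
  \<open>P * X * Q\<close> is additive and multiplicative, hence carries brackets to
  brackets.\<close>

lemma commutators_mat_conj:
  assumes "C \<in> commutators_mat n" "P \<in> carrier_mat n n" "Q \<in> carrier_mat n n" "Q * P = 1\<^sub>m n"
  shows "P * C * Q \<in> commutators_mat n"
proof -
  obtain A B where AB: "A \<in> carrier_mat n n" "B \<in> carrier_mat n n" "C = A * B - B * A"
    using assms(1) unfolding commutators_mat_def by blast
  have *: "P * X * Q * (P * Y * Q) = P * (X * Y) * Q"
    if "X \<in> carrier_mat n n" "Y \<in> carrier_mat n n" for X Y
  proof -
    have "P * X * Q * (P * Y * Q) = P * X * (Q * P) * Y * Q"
      using that assms(2,3) by (simp add: assoc_mult_mat[of _ n n _ n _ n])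
    then show ?thesis
      using that assms by (simp add: assoc_mult_mat[of _ n n _ n _ n])
  qed
  have "P * C * Q = P * (A * B) * Q - P * (B * A) * Q"
    using AB assms(2,3)
    by (simp add: mult_minus_distrib_mat[of _ n n _ n] minus_mult_distrib_mat[of _ n n _ _ n])
  also have "\<dots> = (P * A * Q) * (P * B * Q) - (P * B * Q) * (P * A * Q)"
    using AB * by simp
  finally show ?thesis
    using AB assms(2,3) by (metis commutators_matI mult_carrier_mat)
qed

lemma similar_matE:
  assumes "similar_mat A B" "B \<in> carrier_mat n n"
  obtains P Q where "P \<in> carrier_mat n n" "Q \<in> carrier_mat n n"
    "P * Q = 1\<^sub>m n" "Q * P = 1\<^sub>m n" "A = P * B * Q"
proof -
  obtain m P Q where PQ: "{A, B, P, Q} \<subseteq> carrier_mat m m" "P * Q = 1\<^sub>m m" "Q * P = 1\<^sub>m m" "A = P * B * Q"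
    using similar_matD[OF assms(1)] by blast
  then have "m = n"
    using assms(2) by (metis carrier_matD(1) insert_subset)
  then show thesis
    using PQ that by auto
qed

lemma commutators_mat_similar:
  assumes "similar_mat A B" "B \<in> commutators_mat n"
  shows "A \<in> commutators_mat n"
  using similar_matE[OF assms(1) commutators_mat_carrier[OF assms(2)]] commutators_mat_conj[OF assms(2)]
  by metis

definition product_of_commutators :: "nat \<Rightarrow> 'a::ring_1 mat \<Rightarrow> bool" where
  "product_of_commutators n M \<longleftrightarrow> (\<exists>C \<in> commutators_mat n. \<exists>D \<in> commutators_mat n. M = C * D)"

lemma product_of_commutatorsI:
  "C \<in> commutators_mat n \<Longrightarrow> D \<in> commutators_mat n \<Longrightarrow> M = C * D \<Longrightarrow> product_of_commutators n M"
  unfolding product_of_commutators_def by blast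

lemma product_of_commutators_similar:
  assumes "similar_mat A B" "product_of_commutators n B"
  shows "product_of_commutators n A"
proof -
  obtain C D where CD: "C \<in> commutators_mat n" "D \<in> commutators_mat n" "B = C * D"
    using assms(2) unfolding product_of_commutators_def by blast
  note c = commutators_mat_carrier[OF CD(1)] commutators_mat_carrier[OF CD(2)]
  have B: "B \<in> carrier_mat n n"
    using c CD(3) by simp
  obtain P Q where PQ: "P \<in> carrier_mat n n" "Q \<in> carrier_mat n n"
    "Q * P = 1\<^sub>m n" "A = P * B * Q"
    using similar_matE[OF assms(1) B] by metis
  have "P * C * Q * (P * D * Q) = P * C * (Q * P) * D * Q"
    using PQ(1,2) c by (simp add: assoc_mult_mat[of _ n n _ n _ n])
  also have "\<dots> = P * B * Q"
    using PQ(1-3) c CD(3) by (simp add: assoc_mult_mat[of _ n n _ n _ n])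
  finally show ?thesis
    using commutators_mat_conj[OF CD(1) PQ(1-3)] commutators_mat_conj[OF CD(2) PQ(1-3)] PQ(4)
    by (metis product_of_commutatorsI)
qed

section \<open>Entrywise products and simultaneous permutation of rows and columns\<close>

lemma index_mult_mat_sum:
  "A \<in> carrier_mat nr n \<Longrightarrow> B \<in> carrier_mat n nc \<Longrightarrow> i < nr \<Longrightarrow> j < nc \<Longrightarrow>
    (A * B) $$ (i, j) = (\<Sum>k<n. A $$ (i, k) * B $$ (k, j))"
  by (simp add: scalar_prod_def atLeast0LessThan)

lemma sum_if_eq_mult:
  fixes f :: "nat \<Rightarrow> 'a::semiring_1"
  shows "(\<Sum>k<n. (if k = a then 1 else 0) * f k) = (if a < n then f a else 0)"
    and "(\<Sum>k<n. f k * (if k = a then 1 else 0)) = (if a < n then f a else 0)"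
  by (simp_all add: if_distrib[of "\<lambda>x. x * _"] if_distrib[of "\<lambda>x. _ * x"] cong: if_cong)

lemma similar_mat_permute:
  fixes A :: "'a::ring_1 mat"
  assumes A: "A \<in> carrier_mat n n" and pi: "\<pi> permutes {..<n}"
  shows "similar_mat (mat n n (\<lambda>(i, j). A $$ (\<pi> i, \<pi> j))) A"
proof -
  have lt: "\<pi> i < n \<longleftrightarrow> i < n" for i
    using permutes_in_image[OF pi] by simp
  have inj: "\<pi> i = \<pi> j \<longleftrightarrow> i = j" for i j
    using permutes_inj[OF pi] by (simp add: inj_eq)
  let ?P = "mat n n (\<lambda>(i, j). if j = \<pi> i then 1 else 0) :: 'a mat"
  let ?Q = "mat n n (\<lambda>(i, j). if i = \<pi> j then 1 else 0) :: 'a mat"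
  have QP: "?Q * ?P = 1\<^sub>m n"
  proof (rule eq_matI)
    fix i j assume "i < dim_row (1\<^sub>m n :: 'a mat)" "j < dim_col (1\<^sub>m n :: 'a mat)"
    then have ij: "i < n" "j < n" by auto
    \<comment> \<open>The preimage of \<open>i\<close> turns the condition
      \<open>i = \<pi> k\<close> into \<open>k = i'\<close>, the form in which a Kronecker delta sum
      can be evaluated.\<close>
    obtain i' where i': "i = \<pi> i'" "i' < n"
      using permutes_surj[OF pi] lt ij(1) by (metis surjD)
    have "(?Q * ?P) $$ (i, j) = (\<Sum>k<n. (if k = i' then 1 else 0) * (if j = \<pi> k then 1 else 0))"
      using ij i' by (subst index_mult_mat_sum[of _ n n _ n]) (auto simp: inj intro!: sum.cong)
    then show "(?Q * ?P) $$ (i, j) = 1\<^sub>m n $$ (i, j)"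
      using i' ij by (simp only: sum_if_eq_mult) auto
  qed auto
  have PQ: "?P * ?Q = 1\<^sub>m n"
  proof (rule eq_matI)
    fix i j assume "i < dim_row (1\<^sub>m n :: 'a mat)" "j < dim_col (1\<^sub>m n :: 'a mat)"
    then have ij: "i < n" "j < n" by auto
    have "(?P * ?Q) $$ (i, j) = (\<Sum>k<n. (if k = \<pi> i then 1 else 0) * (if k = \<pi> j then 1 else 0))"
      using ij by (subst index_mult_mat_sum[of _ n n _ n]) (auto intro!: sum.cong)
    then show "(?P * ?Q) $$ (i, j) = 1\<^sub>m n $$ (i, j)"
      using ij lt by (simp only: sum_if_eq_mult) (auto simp: inj)
  qed auto
  have PA: "(?P * A) $$ (i, k) = A $$ (\<pi> i, k)" if "i < n" "k < n" for i k
    using that A lt by (subst index_mult_mat_sum[of _ n n _ n]) (auto simp: sum_if_eq_mult)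
  have "mat n n (\<lambda>(i, j). A $$ (\<pi> i, \<pi> j)) = ?P * A * ?Q"
  proof (rule eq_matI)
    fix i j assume "i < dim_row (?P * A * ?Q)" "j < dim_col (?P * A * ?Q)"
    then have ij: "i < n" "j < n" by auto
    have "(?P * A * ?Q) $$ (i, j) = (\<Sum>k<n. A $$ (\<pi> i, k) * (if k = \<pi> j then 1 else 0))"
      using ij A by (subst index_mult_mat_sum[of _ n n _ n]) (auto simp: PA simp del: index_mult_mat(1) intro!: sum.cong)
    then show "mat n n (\<lambda>(i, j). A $$ (\<pi> i, \<pi> j)) $$ (i, j) = (?P * A * ?Q) $$ (i, j)"
      using ij lt by (simp add: sum_if_eq_mult del: index_mult_mat(1))
  qed auto
  then show ?thesis
    using A PQ QP by (intro similar_matI[of _ _ _ _ n]) auto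
qed

section \<open>Commutators from vanishing diagonal sums\<close>

text \<open>The equation \<open>J * X - X * J = A\<close> says that moving one step down a diagonal
  of \<open>X\<close> adds an entry of \<open>A\<close>. Starting with a zero top row, the entries
  of \<open>X\<close> are therefore partial diagonal sums of \<open>A\<close>. The only obstruction
  is that the recursion must return 0 in the fictitious row \<open>n\<close>, and there it returns a
  full diagonal sum.\<close>

lemma null_diagonals_commutator:
  assumes "null_diagonals n A"
  shows "A \<in> commutators_mat n"
proof -
  have A: "A \<in> carrier_mat n n" and s: "\<And>d. (\<Sum>j<n - d. A $$ (j + d, j)) = 0"
    using assms unfolding null_diagonals_def by auto
  \<comment> \<open>The sum runs up and to the left from position \<open>(i - 1, j)\<close>; the
    minimum stops it at the top row or at the left column.\<close>
  define x where "x i j = (\<Sum>k<min i (Suc j). A $$ (i - Suc k, j - k))" for i j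
  define X where "X = mat n n (\<lambda>(i, j). x i j)"
  define J :: "'a mat" where "J = mat n n (\<lambda>(i, j). if j = Suc i then 1 else 0)"
  have x0: "x (Suc i) 0 = A $$ (i, 0)" for i
    by (simp add: x_def)
  have xS: "x (Suc i) (Suc j) = A $$ (i, Suc j) + x i j" for i j
    by (simp add: x_def sum.lessThan_Suc_shift del: sum.lessThan_Suc)
  have xn: "x n j = 0" if "j < n" for j
  proof -
    have "x n j = (\<Sum>k<Suc j. A $$ (n - Suc k, j - k))"
      using that by (simp add: x_def min_absorb2 del: sum.lessThan_Suc)
    \<comment> \<open>Reversing the order of summation makes the sum start in column 0, which
      matches the diagonal of offset \<open>n - Suc j\<close>.\<close>
    also have "\<dots> = (\<Sum>k<Suc j. A $$ (n - Suc (Suc j - Suc k), j - (Suc j - Suc k)))"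
      by (rule sum.nat_diff_reindex[symmetric])
    also have "\<dots> = (\<Sum>k<n - (n - Suc j). A $$ (k + (n - Suc j), k))"
      using that by (intro sum.cong) (auto intro!: arg_cong[of _ _ "($$) A"])
    finally show ?thesis
      using s by simp
  qed
  have "J * X - X * J = A"
  proof (rule eq_matI)
    fix i j assume "i < dim_row A" "j < dim_col A"
    then have ij: "i < n" "j < n" using A by auto
    have "(J * X) $$ (i, j) = (if Suc i < n then x (Suc i) j else 0)"
      using ij by (subst index_mult_mat_sum[of _ n n _ n]) (auto simp: J_def X_def sum_if_eq_mult)
    also have "\<dots> = x (Suc i) j"
      using xn ij by (cases "Suc i = n") auto
    finally have JX: "(J * X) $$ (i, j) = x (Suc i) j" .
    have XJ: "(X * J) $$ (i, j) = (if j = 0 then 0 else x i (j - 1))"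
    proof -
      have "(X * J) $$ (i, j) = (\<Sum>k<n. x i k * (if Suc k = j then 1 else 0))"
        using ij by (subst index_mult_mat_sum[of _ n n _ n]) (auto simp: J_def X_def intro!: sum.cong)
      also have "\<dots> = (if j = 0 then 0 else x i (j - 1))"
        using ij by (cases j) (simp_all add: sum_if_eq_mult(2))
      finally show ?thesis .
    qed
    show "(J * X - X * J) $$ (i, j) = A $$ (i, j)"
    proof -
      have "(J * X - X * J) $$ (i, j) = x (Suc i) j - (if j = 0 then 0 else x i (j - 1))"
        using ij JX XJ by (simp add: J_def X_def del: index_mult_mat(1))
      then show ?thesis
        using x0 xS by (cases j) auto
    qed
  qed (use A in \<open>auto simp: J_def X_def\<close>)
  then show ?thesis
    by (metis commutators_matI J_def X_def mat_carrier)
qed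

text \<open>Reversing the order of the basis sends position \<open>(i, j)\<close> to
  \<open>(n - 1 - i, n - 1 - j)\<close> and so exchanges the diagonals above and below the main one.
  Hence vanishing sums on and above the main diagonal serve equally well.\<close>

lemma transpose_null_diagonals_commutator:
  assumes "null_diagonals n (transpose_mat A)"
  shows "A \<in> commutators_mat n"
proof -
  have A: "A \<in> carrier_mat n n" and s: "\<And>d. (\<Sum>j<n - d. transpose_mat A $$ (j + d, j)) = 0"
    using assms unfolding null_diagonals_def by auto
  define \<pi> where "\<pi> i = (if i < n then n - Suc i else i)" for i
  have "\<pi> permutes {..<n}"
    by (rule bij_imp_permutes) (auto simp: \<pi>_def intro!: bij_betwI[of _ _ _ \<pi>])
  then have sim: "similar_mat A (mat n n (\<lambda>(i, j). A $$ (\<pi> i, \<pi> j)))"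
    using similar_mat_permute[OF A] similar_mat_sym by blast
  have "null_diagonals n (mat n n (\<lambda>(i, j). A $$ (\<pi> i, \<pi> j)))"
    unfolding null_diagonals_def
  proof safe
    fix d
    have "(\<Sum>j<n - d. mat n n (\<lambda>(i, j). A $$ (\<pi> i, \<pi> j)) $$ (j + d, j))
      = (\<Sum>j<n - d. A $$ (n - d - Suc j, n - d - Suc j + d))"
      by (intro sum.cong) (auto simp: \<pi>_def intro!: arg_cong[of _ _ "($$) A"])
    also have "\<dots> = (\<Sum>j<n - d. A $$ (j, j + d))"
      by (rule sum.nat_diff_reindex)
    also have "\<dots> = (\<Sum>j<n - d. transpose_mat A $$ (j + d, j))"
      using A by (intro sum.cong) auto
    finally show "(\<Sum>j<n - d. mat n n (\<lambda>(i, j). A $$ (\<pi> i, \<pi> j)) $$ (j + d, j)) = 0"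
      using s by simp
  qed auto
  then show ?thesis
    using commutators_mat_similar[OF sim] null_diagonals_commutator by blast
qed

section \<open>Block matrices\<close>

lemma sum_diff_if:
  fixes f :: "nat \<Rightarrow> 'a::comm_monoid_add"
  shows "(\<Sum>j<n - d. f j) = (\<Sum>j<n. if j + d < n then f j else 0)"
proof -
  have "{j. j < n \<and> j + d < n} = {..<n - d}" by auto
  then show ?thesis
    by (simp add: sum.If_cases Int_def)
qed

lemma sum_lessThan_add:
  fixes f :: "nat \<Rightarrow> 'a::comm_monoid_add"
  shows "(\<Sum>j<p + q. f j) = (\<Sum>j<p. f j) + (\<Sum>j<q. f (p + j))"
  by (induction q) (simp_all add: add.assoc)

lemma null_diagonals_carrier: "null_diagonals n A \<Longrightarrow> A \<in> carrier_mat n n"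
  unfolding null_diagonals_def by simp

text \<open>A diagonal on or below the main one never meets the upper right block, so its sum is the
  sum of the diagonals of the same offset in \<open>P\<close> and \<open>Q\<close>.\<close>

lemma null_diagonals_four_block:
  assumes P: "null_diagonals p P" and Q: "null_diagonals q Q" and Y: "Y \<in> carrier_mat p q"
  shows "null_diagonals (p + q) (four_block_mat P Y (0\<^sub>m q p) Q)"
  unfolding null_diagonals_def
proof safe
  note c = null_diagonals_carrier[OF P] null_diagonals_carrier[OF Q]
  let ?F = "four_block_mat P Y (0\<^sub>m q p) Q"
  show "?F \<in> carrier_mat (p + q) (p + q)"
    using c by simp
  fix d
  have "(\<Sum>j<p + q - d. ?F $$ (j + d, j)) = (\<Sum>j<p. if j + d < p + q then ?F $$ (j + d, j) else 0)
    + (\<Sum>j<q. if p + j + d < p + q then ?F $$ (p + j + d, p + j) else 0)"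
    by (simp only: sum_diff_if sum_lessThan_add)
  also have "(\<Sum>j<p. if j + d < p + q then ?F $$ (j + d, j) else 0) = (\<Sum>j<p - d. P $$ (j + d, j))"
    unfolding sum_diff_if using c by (intro sum.cong) auto
  also have "(\<Sum>j<q. if p + j + d < p + q then ?F $$ (p + j + d, p + j) else 0)
      = (\<Sum>j<q - d. Q $$ (j + d, j))"
    unfolding sum_diff_if using c by (intro sum.cong) (auto simp: add.assoc)
  finally show "(\<Sum>j<p + q - d. ?F $$ (j + d, j)) = 0"
    using P Q unfolding null_diagonals_def by simp
qed

lemma null_diagonals_smult:
  "null_diagonals n A \<Longrightarrow> null_diagonals n (c \<cdot>\<^sub>m A)"
  unfolding null_diagonals_def
proof safe
  fix d assume A: "A \<in> carrier_mat n n" and "\<forall>d. (\<Sum>j<n - d. A $$ (j + d, j)) = 0"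
  moreover have "(\<Sum>j<n - d. (c \<cdot>\<^sub>m A) $$ (j + d, j)) = c * (\<Sum>j<n - d. A $$ (j + d, j))"
    unfolding sum_distrib_left using A by (intro sum.cong) auto
  ultimately show "(\<Sum>j<n - d. (c \<cdot>\<^sub>m A) $$ (j + d, j)) = 0"
    by simp
qed simp

text \<open>Serves block sums whose two blocks are commutators for different reasons, so that no
  single criterion on diagonal sums applies to the whole matrix.\<close>

lemma commutators_mat_four_block:
  assumes C: "C \<in> commutators_mat p" and D: "D \<in> commutators_mat q"
  shows "four_block_mat C (0\<^sub>m p q) (0\<^sub>m q p) D \<in> commutators_mat (p + q)"
proof -
  obtain A B where AB: "A \<in> carrier_mat p p" "B \<in> carrier_mat p p" "C = A * B - B * A"
    using C unfolding commutators_mat_def by blast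
  obtain X Y where XY: "X \<in> carrier_mat q q" "Y \<in> carrier_mat q q" "D = X * Y - Y * X"
    using D unfolding commutators_mat_def by blast
  let ?A = "four_block_mat A (0\<^sub>m p q) (0\<^sub>m q p) X" and ?B = "four_block_mat B (0\<^sub>m p q) (0\<^sub>m q p) Y"
  have "?A * ?B = four_block_mat (A * B) (0\<^sub>m p q) (0\<^sub>m q p) (X * Y)"
    "?B * ?A = four_block_mat (B * A) (0\<^sub>m p q) (0\<^sub>m q p) (Y * X)"
    using AB XY by (subst mult_four_block_mat[of _ p p _ q _ q _ _ p _ q]; simp)+
  moreover have "four_block_mat C (0\<^sub>m p q) (0\<^sub>m q p) D
    = four_block_mat (A * B) (0\<^sub>m p q) (0\<^sub>m q p) (X * Y) - four_block_mat (B * A) (0\<^sub>m p q) (0\<^sub>m q p) (Y * X)"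
    using AB XY by (intro eq_matI) auto
  ultimately show ?thesis
    using AB XY by (metis commutators_matI four_block_carrier_mat)
qed

section \<open>Change of one basis vector\<close>

text \<open>This is conjugation by the identity matrix with column \<open>k\<close> replaced by
  \<open>v\<close>, that is, the \<open>k\<close>-th basis vector is exchanged for \<open>v\<close>.
  \<open>K\<close> is the product of \<open>M\<close> with that matrix; its column \<open>k\<close>
  is the image of \<open>v\<close>.\<close>

lemma similar_replace_column:
  fixes M :: "'a::division_ring mat" and v :: "nat \<Rightarrow> 'a" and k :: nat
  defines "K i j \<equiv> (if j = k then \<Sum>l<dim_row M. M $$ (i, l) * v l else M $$ (i, j))"
  assumes M: "M \<in> carrier_mat n n" and k: "k < n" and vk: "v k \<noteq> 0"
  obtains N where "similar_mat N M" "N \<in> carrier_mat n n"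
    "\<And>i j. i < n \<Longrightarrow> j < n \<Longrightarrow> N $$ (i, j) =
      (if i = k then inverse (v k) * K k j else K i j - v i * inverse (v k) * K k j)"
proof -
  define S where "S = mat n n (\<lambda>(i, j). if j = k then v i else if i = j then 1 else 0)"
  define c where "c i = (if i = k then inverse (v k) else - (v i * inverse (v k)))" for i
  define T where "T = mat n n (\<lambda>(i, j). if j = k then c i else if i = j then 1 else 0)"
  have ST: "S \<in> carrier_mat n n" "T \<in> carrier_mat n n"
    by (auto simp: S_def T_def)
  \<comment> \<open>Both \<open>S\<close> and its inverse \<open>T\<close> differ from the identity
    only in column \<open>k\<close>, so one formula for left multiplication covers them.\<close>
  have L: "(mat n n (\<lambda>(i, j). if j = k then w i else if i = j then 1 else 0) * X) $$ (i, j)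
      = w i * X $$ (k, j) + (if i = k then 0 else X $$ (i, j))"
    if "X \<in> carrier_mat n n" "i < n" "j < n" for w :: "nat \<Rightarrow> 'a" and X i j
  proof -
    have "(mat n n (\<lambda>(i, j). if j = k then w i else if i = j then 1 else 0) * X) $$ (i, j)
      = (\<Sum>l<n. (if l = k then w i else if i = l then 1 else 0) * X $$ (l, j))"
      using that by (subst index_mult_mat_sum[of _ n n _ n]) auto
    also have "\<dots> = (\<Sum>l<n. (if l = k then w i * X $$ (k, j) else 0) + (if l = i then (if i = k then 0 else X $$ (i, j)) else 0))"
      by (intro sum.cong) auto
    also have "\<dots> = w i * X $$ (k, j) + (if i = k then 0 else X $$ (i, j))"
      using that k by (simp add: sum.distrib)
    finally show ?thesis .
  qed
  have MS: "(M * S) $$ (i, j) = K i j" if "i < n" "j < n" for i j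
  proof (cases "j = k")
    case False
    then have "(M * S) $$ (i, j) = (\<Sum>l<n. M $$ (i, l) * (if l = j then 1 else 0))"
      using that M ST by (subst index_mult_mat_sum[of _ n n _ n]) (auto simp: S_def intro!: sum.cong)
    with False that show ?thesis
      by (simp add: sum_if_eq_mult K_def)
  qed (use that M ST in \<open>subst index_mult_mat_sum[of _ n n _ n]; auto simp: S_def K_def\<close>)
  have "S * T = 1\<^sub>m n"
  proof (rule eq_matI)
    fix i j assume "i < dim_row (1\<^sub>m n :: 'a mat)" "j < dim_col (1\<^sub>m n :: 'a mat)"
    then show "(S * T) $$ (i, j) = 1\<^sub>m n $$ (i, j)"
      unfolding S_def using ST(2) k vk by (subst L) (auto simp: T_def c_def)
  qed (use ST in auto)
  moreover have "T * S = 1\<^sub>m n"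
  proof (rule eq_matI)
    fix i j assume "i < dim_row (1\<^sub>m n :: 'a mat)" "j < dim_col (1\<^sub>m n :: 'a mat)"
    then show "(T * S) $$ (i, j) = 1\<^sub>m n $$ (i, j)"
      unfolding T_def using ST(1) k vk by (subst L) (auto simp: S_def c_def mult.assoc)
  qed (use ST in auto)
  ultimately have "similar_mat (T * (M * S)) M"
    using M ST by (intro similar_matI[of _ _ T S n]) (auto simp: assoc_mult_mat[of _ n n _ n _ n])
  moreover have "(T * (M * S)) $$ (i, j) =
      (if i = k then inverse (v k) * K k j else K i j - v i * inverse (v k) * K k j)"
    if "i < n" "j < n" for i j
    unfolding T_def using that M ST k by (subst L) (auto simp: MS c_def simp del: index_mult_mat(1))
  ultimately show thesis
    using that[of "T * (M * S)"] M ST by auto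
qed

section \<open>Scalar matrices and singular matrices\<close>

lemma smult_mult_mat:
  fixes A B :: "'a::semiring_0 mat"
  assumes "A \<in> carrier_mat nr n" "B \<in> carrier_mat n nc"
  shows "(c \<cdot>\<^sub>m A) * B = c \<cdot>\<^sub>m (A * B)"
  using assms by (intro eq_matI) (auto simp: scalar_prod_def sum_distrib_left mult.assoc)

lemma null_diagonals_2:
  assumes "a + d = 0"
  shows "null_diagonals 2 (mat_of_rows_list 2 [[a, b], [0, d]])"
  unfolding null_diagonals_def
proof safe
  fix k :: nat
  consider "k = 0" | "k = 1" | "k \<ge> 2" by linarith
  then show "(\<Sum>j<2 - k. mat_of_rows_list 2 [[a, b], [0, d]] $$ (j + k, j)) = 0"
    by cases (use assms in \<open>auto simp: mat_of_rows_list_def numeral_2_eq_2\<close>)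
qed (auto simp: mat_of_rows_list_def)

lemma null_diagonals_3:
  assumes "a + e + i = 0" "d + h = 0"
  shows "null_diagonals 3 (mat_of_rows_list 3 [[a, b, c], [d, e, f], [0, h, i]])"
  unfolding null_diagonals_def
proof safe
  fix k :: nat
  consider "k = 0" | "k = 1" | "k = 2" | "k \<ge> 3" by linarith
  then show "(\<Sum>j<3 - k. mat_of_rows_list 3 [[a, b, c], [d, e, f], [0, h, i]] $$ (j + k, j)) = 0"
    by cases (use assms in \<open>auto simp: mat_of_rows_list_def numeral_3_eq_3\<close>)
qed (auto simp: mat_of_rows_list_def)

text \<open>Every size other than 1 is a sum of twos and threes, and signed permutations exist in
  both sizes: \<open>diag(1, -1)\<close> and a signed 3-cycle. Treating 3 as a base case keeps the
  descent by 2 from reaching 1.\<close>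

lemma exists_orthogonal_null_diagonals:
  assumes "m \<noteq> 1"
  shows "\<exists>R :: 'a::ring_1 mat. null_diagonals m R \<and> R * transpose_mat R = 1\<^sub>m m \<and> transpose_mat R * R = 1\<^sub>m m"
  using assms
proof (induction m rule: less_induct)
  case (less m)
  consider "m = 0" | "m = 3" | "m \<noteq> 3" "m \<ge> 2"
    using less.prems by linarith
  then show ?case
  proof cases
    case 1
    have "null_diagonals 0 (1\<^sub>m 0 :: 'a mat)"
      by (simp add: null_diagonals_def)
    then show ?thesis
      using 1 by (intro exI[of _ "1\<^sub>m 0"]) simp
  next
    case 2
    let ?R = "mat_of_rows_list 3 [[0, 0, 1], [1, 0, 0], [0, - 1, 0]] :: 'a mat"
    have "null_diagonals 3 ?R"
      by (rule null_diagonals_3) simp_all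
    moreover have "?R * transpose_mat ?R = 1\<^sub>m 3" "transpose_mat ?R * ?R = 1\<^sub>m 3"
      by (intro eq_matI; auto simp: mat_of_rows_list_def scalar_prod_def less_Suc_eq numeral_3_eq_3)+
    ultimately show ?thesis
      using 2 by blast
  next
    case 3
    define q where "q = m - 2"
    obtain R :: "'a mat" where R: "null_diagonals q R" "R * transpose_mat R = 1\<^sub>m q" "transpose_mat R * R = 1\<^sub>m q"
    proof -
      have "q < m" "q \<noteq> 1" using 3 by (auto simp: q_def)
      then show thesis using less.IH that by blast
    qed
    note c = null_diagonals_carrier[OF R(1)]
    let ?P = "mat_of_rows_list 2 [[1, 0], [0, - 1]] :: 'a mat"
    have P: "null_diagonals 2 ?P"
      by (rule null_diagonals_2) simp
    have PP: "?P \<in> carrier_mat 2 2" "?P * transpose_mat ?P = 1\<^sub>m 2" "transpose_mat ?P * ?P = 1\<^sub>m 2"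
      by (auto intro!: eq_matI simp: mat_of_rows_list_def scalar_prod_def less_Suc_eq numeral_2_eq_2)
    let ?F = "four_block_mat ?P (0\<^sub>m 2 q) (0\<^sub>m q 2) R"
    have T: "transpose_mat ?F = four_block_mat (transpose_mat ?P) (0\<^sub>m 2 q) (0\<^sub>m q 2) (transpose_mat R)"
      using c PP(1) by (subst transpose_four_block_mat[of _ 2 2 _ q _ q]) auto
    have "null_diagonals (2 + q) ?F"
      using null_diagonals_four_block[OF P R(1)] by simp
    moreover have "?F * transpose_mat ?F = 1\<^sub>m (2 + q)" "transpose_mat ?F * ?F = 1\<^sub>m (2 + q)"
      unfolding T using c PP R
      by (subst mult_four_block_mat[of _ 2 2 _ q _ q _ _ 2 _ q]; simp)+
    moreover have "2 + q = m"
      using 3 by (simp add: q_def)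
    ultimately show ?thesis
      by metis
  qed
qed

text \<open>The scalar is absorbed by a signed permutation \<open>R\<close>, which has vanishing
  sums below the diagonal, while the inverse of \<open>R\<close> is its transpose and has them
  above.\<close>

lemma product_of_commutators_scalar:
  fixes c :: "'a::ring_1"
  assumes "n \<noteq> 1"
  shows "product_of_commutators n (c \<cdot>\<^sub>m 1\<^sub>m n)"
proof -
  obtain R :: "'a mat" where R: "null_diagonals n R" "R * transpose_mat R = 1\<^sub>m n"
    using exists_orthogonal_null_diagonals[OF assms] by blast
  note car = null_diagonals_carrier[OF R(1)]
  show ?thesis
  proof (rule product_of_commutatorsI)
    show "c \<cdot>\<^sub>m R \<in> commutators_mat n"
      by (intro null_diagonals_commutator null_diagonals_smult R(1))
    show "transpose_mat R \<in> commutators_mat n"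
      by (intro transpose_null_diagonals_commutator) (simp add: R(1))
    show "c \<cdot>\<^sub>m 1\<^sub>m n = c \<cdot>\<^sub>m R * transpose_mat R"
      using car R(2) by (simp add: smult_mult_mat[of _ n n _ n])
  qed
qed

text \<open>A zero first column lets \<open>M\<close> be written as \<open>A * U\<close> with
  \<open>U\<close> the shift, where \<open>A\<close> is \<open>M\<close> moved one column to the
  left. The last column of \<open>A\<close> is free, and every diagonal on or above the main one
  ends there.\<close>

lemma product_of_commutators_zero_column:
  fixes M :: "'a::ring_1 mat"
  assumes M: "M \<in> carrier_mat n n" and z: "\<And>i. i < n \<Longrightarrow> M $$ (i, 0) = 0"
  shows "product_of_commutators n M"
proof -
  define U :: "'a mat" where "U = mat n n (\<lambda>(i, j). if j = Suc i then 1 else 0)"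
  \<comment> \<open>The entry of the last column that cancels the rest of the diagonal ending in row
    \<open>i\<close>.\<close>
  define b where "b i = - (\<Sum>k<i. M $$ (k, Suc (k + (n - Suc i))))" for i
  define A where "A = mat n n (\<lambda>(i, j). if Suc j < n then M $$ (i, Suc j) else b i)"
  have "null_diagonals n (transpose_mat A)"
    unfolding null_diagonals_def
  proof safe
    fix d
    show "(\<Sum>j<n - d. transpose_mat A $$ (j + d, j)) = 0"
    proof (cases "d < n")
      case True
      then obtain m where m: "n - d = Suc m"
        by (metis Suc_diff_Suc)
      then have d: "d = n - Suc m" "m < n" using True by auto
      have "(\<Sum>j<m. transpose_mat A $$ (j + d, j)) = (\<Sum>j<m. M $$ (j, Suc (j + d)))"
        using d by (intro sum.cong) (auto simp: A_def)
      moreover have "transpose_mat A $$ (m + d, m) = b m"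
        using d by (auto simp: A_def)
      ultimately show ?thesis
        using d unfolding m by (simp add: b_def)
    qed simp
  qed (simp add: A_def)
  moreover have "null_diagonals n U"
    unfolding null_diagonals_def by (auto simp: U_def intro!: sum.neutral)
  moreover have "M = A * U"
  proof (rule eq_matI)
    fix i j assume "i < dim_row (A * U)" "j < dim_col (A * U)"
    then have ij: "i < n" "j < n" by (auto simp: U_def A_def)
    have "(A * U) $$ (i, j) = (\<Sum>k<n. A $$ (i, k) * (if Suc k = j then 1 else 0))"
      using ij by (subst index_mult_mat_sum[of _ n n _ n]) (auto simp: U_def A_def intro!: sum.cong)
    also have "\<dots> = M $$ (i, j)"
      using ij z by (cases j) (simp_all add: sum_if_eq_mult A_def)
    finally show "M $$ (i, j) = (A * U) $$ (i, j)"
      by simp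
  qed (use M in \<open>auto simp: U_def A_def\<close>)
  ultimately show ?thesis
    by (intro product_of_commutatorsI[of A n U])
      (auto intro: null_diagonals_commutator transpose_null_diagonals_commutator)
qed

text \<open>Taking the kernel vector as a basis vector produces a zero column, which a transposition
  moves to the front.\<close>

lemma product_of_commutators_kernel:
  fixes M :: "'a::division_ring mat"
  assumes M: "M \<in> carrier_mat n n" and k: "k < n" "v k \<noteq> 0"
    and v: "\<And>i. i < n \<Longrightarrow> (\<Sum>l<n. M $$ (i, l) * v l) = 0"
  shows "product_of_commutators n M"
proof -
  have d: "dim_row M = n"
    using M by simp
  obtain N where N: "similar_mat N M" "N \<in> carrier_mat n n" "\<And>i. i < n \<Longrightarrow> N $$ (i, k) = 0"
    by (rule similar_replace_column[of M n k v, OF M k]) (use k v in \<open>auto simp: d\<close>)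
  let ?\<pi> = "transpose 0 k"
  have "?\<pi> permutes {..<n}"
    using k by (intro permutes_swap_id) auto
  then have "similar_mat N (mat n n (\<lambda>(i, j). N $$ (?\<pi> i, ?\<pi> j)))" (is "similar_mat N ?N")
    using similar_mat_permute[OF N(2)] similar_mat_sym by blast
  moreover have "product_of_commutators n ?N"
    using k N(3) by (intro product_of_commutators_zero_column) (auto simp: transpose_def)
  ultimately show ?thesis
    using N(1) product_of_commutators_similar similar_mat_sym by blast
qed

section \<open>Normalising the first column\<close>

text \<open>The basis vector \<open>k\<close> is replaced by the sum of the basis vectors
  \<open>k\<close> and \<open>l\<close>. This is used to turn a difference of diagonal entries, or
  an entry in another column, into a nonzero off-diagonal entry.\<close>

lemma similar_transvection:
  fixes M :: "'a::division_ring mat"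
  assumes M: "M \<in> carrier_mat n n" and kl: "k < n" "l < n" "k \<noteq> l"
  obtains N where "similar_mat N M" "N \<in> carrier_mat n n"
    "\<And>i j. i < n \<Longrightarrow> j < n \<Longrightarrow> N $$ (i, j) = M $$ (i, j) + (if j = k then M $$ (i, l) else 0)
      - (if i = l then M $$ (k, j) + (if j = k then M $$ (k, l) else 0) else 0)"
proof -
  define v where "v h = (if h = k \<or> h = l then 1 else 0 :: 'a)" for h
  define w where "w i = (\<Sum>h<dim_row M. M $$ (i, h) * v h)" for i
  have v: "v k = 1" "v l = 1" "\<And>h. h \<noteq> k \<Longrightarrow> h \<noteq> l \<Longrightarrow> v h = 0"
    by (auto simp: v_def)
  have w: "w i = M $$ (i, k) + M $$ (i, l)" for i
  proof -
    have "w i = (\<Sum>h<n. (if h = k then M $$ (i, k) else 0) + (if h = l then M $$ (i, l) else 0))"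
      unfolding w_def using kl M by (intro sum.cong) (auto simp: v_def)
    then show ?thesis
      using kl by (simp add: sum.distrib)
  qed
  obtain N where N: "similar_mat N M" "N \<in> carrier_mat n n"
    "\<And>i j. i < n \<Longrightarrow> j < n \<Longrightarrow> N $$ (i, j) =
      (if i = k then inverse (v k) * (if j = k then w k else M $$ (k, j))
       else (if j = k then w i else M $$ (i, j)) - v i * inverse (v k) * (if j = k then w k else M $$ (k, j)))"
    using similar_replace_column[of M n k v, OF M kl(1)] v(1) unfolding w_def by auto
  have "N $$ (i, j) = M $$ (i, j) + (if j = k then M $$ (i, l) else 0)
      - (if i = l then M $$ (k, j) + (if j = k then M $$ (k, l) else 0) else 0)" if "i < n" "j < n" for i j
    unfolding N(3)[OF that] w using kl v by (cases "i = l"; cases "i = k") auto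
  then show thesis
    using that N(1,2) by blast
qed

text \<open>If the first column has a nonzero entry in row \<open>k\<close>, that column can replace
  the basis vector \<open>k\<close>. Any nonzero off-diagonal entry can be permuted into this
  position, and a diagonal matrix with two different entries acquires one through a transvection.
  What remains is \<open>c\<close> times the identity, where \<open>c\<close> may fail to be
  central.\<close>

lemma unit_first_column_or_scalar:
  fixes M :: "'a::division_ring mat"
  assumes M: "M \<in> carrier_mat n n" and k: "0 < k" "k < n"
  shows "(\<exists>c. M = c \<cdot>\<^sub>m 1\<^sub>m n) \<or>
    (\<exists>N. similar_mat N M \<and> N \<in> carrier_mat n n \<and> (\<forall>i<n. N $$ (i, 0) = (if i = k then 1 else 0)))"
proof -
  define P where "P X \<longleftrightarrow> X \<in> carrier_mat n n \<and> similar_mat X M" for X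
  have P_trans: "P Y" if "similar_mat Y X" "Y \<in> carrier_mat n n" "P X" for X Y
    using that similar_mat_trans by (auto simp: P_def)
  have 1: "\<exists>N. P N \<and> (\<forall>i<n. N $$ (i, 0) = (if i = k then 1 else 0))"
    if X: "P X" "X $$ (k, 0) \<noteq> 0" for X
  proof -
    have Xc: "X \<in> carrier_mat n n"
      using X by (simp add: P_def)
    obtain N where N: "similar_mat N X" "N \<in> carrier_mat n n"
      "\<And>i j. i < n \<Longrightarrow> j < n \<Longrightarrow> j \<noteq> k \<Longrightarrow> N $$ (i, j) = (if i = k then inverse (X $$ (k, 0)) * X $$ (k, j)
        else X $$ (i, j) - X $$ (i, 0) * inverse (X $$ (k, 0)) * X $$ (k, j))"
      by (rule similar_replace_column[of X n k "\<lambda>i. X $$ (i, 0)", OF Xc k(2) X(2)]) auto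
    have "\<forall>i<n. N $$ (i, 0) = (if i = k then 1 else 0)"
      using N(3) k X(2) by (auto simp: mult.assoc)
    then show ?thesis
      using P_trans[OF N(1,2) X(1)] by blast
  qed
  have 2: "\<exists>N. P N \<and> (\<forall>i<n. N $$ (i, 0) = (if i = k then 1 else 0))"
    if X: "P X" "X $$ (i, j) \<noteq> 0" "i \<noteq> j" "i < n" "j < n" for X i j
  proof -
    \<comment> \<open>\<open>\<tau>\<close> fixes 0 and sends \<open>k\<close> to the preimage of
      \<open>i\<close> under the swap of 0 and \<open>j\<close>, so the composite sends 0 to
      \<open>j\<close> and \<open>k\<close> to \<open>i\<close>.\<close>
    define \<tau> where "\<tau> = transpose k (transpose 0 j i)"
    define \<pi> where "\<pi> = transpose 0 j \<circ> \<tau>"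
    have "transpose 0 j i \<noteq> 0" "transpose 0 j i < n"
      using X k by (auto simp: transpose_def)
    then have pi: "\<pi> permutes {..<n}" "\<pi> 0 = j" "\<pi> k = i"
      using X k unfolding \<pi>_def \<tau>_def
      by (auto intro!: permutes_compose permutes_swap_id simp: transpose_def)
    have "similar_mat (mat n n (\<lambda>(i, j). X $$ (\<pi> i, \<pi> j))) X"
      using X(1) by (intro similar_mat_permute pi) (simp add: P_def)
    then have "P (mat n n (\<lambda>(i, j). X $$ (\<pi> i, \<pi> j)))"
      using P_trans X(1) by simp
    then show ?thesis
      using X pi k by (intro 1) auto
  qed
  show ?thesis
  proof (cases "\<exists>i<n. \<exists>j<n. i \<noteq> j \<and> M $$ (i, j) \<noteq> 0")
    case True
    then show ?thesis
      using 2[of M] M similar_mat_refl[OF M] unfolding P_def by blast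
  next
    case off: False
    show ?thesis
    proof (cases "\<exists>i<n. \<exists>j<n. M $$ (i, i) \<noteq> M $$ (j, j)")
      case True
      then obtain i j where ij: "i < n" "j < n" "M $$ (i, i) \<noteq> M $$ (j, j)" by blast
      then have "i \<noteq> j" by auto
      have z: "M $$ (i, j) = 0" "M $$ (j, i) = 0"
        using off ij \<open>i \<noteq> j\<close> by auto
      obtain N where N: "similar_mat N M" "N \<in> carrier_mat n n" "N $$ (i, j) = M $$ (i, i) - M $$ (j, j)"
        by (rule similar_transvection[OF M ij(2,1)]) (use ij z \<open>i \<noteq> j\<close> in auto)
      then show ?thesis
        using 2[of N i j] ij \<open>i \<noteq> j\<close> unfolding P_def by auto
    next
      case False
      define c where "c = M $$ (0, 0)"
      have "M $$ (i, j) = (if i = j then c else 0)" if "i < n" "j < n" for i j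
        using off False that unfolding c_def by (metis gr_implies_not_zero neq0_conv)
      then have "M = c \<cdot>\<^sub>m 1\<^sub>m n"
        using M by (intro eq_matI) auto
      then show ?thesis by blast
    qed
  qed
qed

section \<open>Nonscalar action modulo the plane\<close>

text \<open>A matrix \<open>N\<close> similar to \<open>M\<close> factors as
  \<open>(N V U) (U^-1 W)\<close>. The first column of \<open>N V\<close> is the unit vector
  \<open>n - 2\<close>, so right multiplication by \<open>U\<close> adds the free first row of
  \<open>U\<close> to row \<open>n - 2\<close>. The left factor \<open>U^-1\<close> alters only
  entries of \<open>W\<close> above the main diagonal. The parameter \<open>t\<close> allows for
  different choices of \<open>W\<close>.\<close>

lemma product_of_commutators_nonscalar_quotient:
  fixes M :: "'a::division_ring mat" and t :: 'a
  assumes M: "M \<in> carrier_mat n n" and n: "n \<ge> 3"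
    and M0: "\<And>i. i < n \<Longrightarrow> M $$ (i, 0) = (if i = n - 2 then 1 else 0)"
    and M1: "M $$ (n - 1, 1) \<noteq> 0"
    and W: "null_diagonals n W" and V: "V \<in> carrier_mat n n" and VW: "V * W = 1\<^sub>m n"
    and W0: "\<And>i. i < n \<Longrightarrow> W $$ (i, 0) = (if i = 0 then 1 else 0)"
    and V0: "\<And>i. i < n \<Longrightarrow> V $$ (i, 0) = (if i = 0 then 1 else 0)"
    and V1: "\<And>i. i < n \<Longrightarrow> V $$ (i, 1) = (if i = 1 then - inverse t else 0)" and t: "t \<noteq> 0"
  shows "product_of_commutators n M"
proof -
  \<comment> \<open>Rescaling the last basis vector by this amount makes the entry
    \<open>(n - 1, 1)\<close> equal to \<open>t\<close>. Multiplication by \<open>V\<close> then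
    turns it into -1, which cancels the 1 at \<open>(n - 2, 0)\<close> on the same diagonal.\<close>
  let ?s = "M $$ (n - 1, 1) * inverse t"
  have d: "dim_row M = n" using M by simp
  obtain N where N: "similar_mat N M" "N \<in> carrier_mat n n"
    "\<And>i j. i < n \<Longrightarrow> j < n - 1 \<Longrightarrow> N $$ (i, j) = (if i = n - 1 then inverse ?s * M $$ (n - 1, j) else M $$ (i, j))"
    by (rule similar_replace_column[of M n "n - 1" "\<lambda>l. if l = n - 1 then ?s else 0", OF M])
      (use n M1 t in auto)
  have N0: "N $$ (i, 0) = (if i = n - 2 then 1 else 0)" if "i < n" for i
    using that n N(3) M0 by auto
  have N1: "N $$ (n - 1, 1) = t"
    using n N(3)[of "n - 1" 1] M1 t by (simp add: nonzero_inverse_mult_distrib mult.assoc)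
  have Wc: "W \<in> carrier_mat n n" using null_diagonals_carrier[OF W] .
  define K where "K = N * V"
  have K: "K \<in> carrier_mat n n"
    using N(2) V by (simp add: K_def)
  have K0: "K $$ (i, 0) = (if i = n - 2 then 1 else 0)" if "i < n" for i
  proof -
    have "K $$ (i, 0) = (\<Sum>l<n. N $$ (i, l) * (if l = 0 then 1 else 0))"
      unfolding K_def using that n V V0 N(2) by (subst index_mult_mat_sum[of _ n n _ n]) auto
    then show ?thesis
      using n N0 that by (simp add: sum_if_eq_mult)
  qed
  have K1: "K $$ (n - 1, 1) = - 1"
  proof -
    have "K $$ (n - 1, 1) = (\<Sum>l<n. N $$ (n - 1, l) * (if l = 1 then - inverse t else 0))"
      unfolding K_def using n V V1 N(2) by (subst index_mult_mat_sum[of _ n n _ n]) auto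
    also have "\<dots> = (\<Sum>l<n. if l = 1 then N $$ (n - 1, 1) * - inverse t else 0)"
      by (intro sum.cong) auto
    finally show ?thesis
      using n N1 t by simp
  qed
  \<comment> \<open>Adding \<open>r j\<close> to the entry \<open>(n - 2, j)\<close> of \<open>K\<close> repairs the diagonal through that entry. The diagonals
    not met this way have sums \<open>1 + K $$ (n - 1, 1)\<close> and \<open>K $$ (n - 1, 0)\<close>, which already vanish.\<close>
  define r where "r j = (if 1 \<le> j \<and> j \<le> n - 2 then - (\<Sum>l<n - (n - 2 - j). K $$ (l + (n - 2 - j), l)) else 0)" for j
  \<comment> \<open>The parameter provides \<open>U\<close> and its inverse together: as
    \<open>r 0 = 0\<close>, the first rows of \<open>U 1\<close> and \<open>U (- 1)\<close> cancel
    in the product.\<close>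
  define U where "U s = mat n n (\<lambda>(i, j). if i = j then 1 else if i = 0 then s * r j else 0)" for s :: 'a
  have Uc: "U s \<in> carrier_mat n n" for s
    by (simp add: U_def)
  have r0: "r 0 = 0"
    by (simp add: r_def)
  have UL: "(U s * X) $$ (i, j) = X $$ (i, j) + (if i = 0 then \<Sum>l<n. s * r l * X $$ (l, j) else 0)"
    if "X \<in> carrier_mat n n" "i < n" "j < n" for s X i j
  proof -
    have "(U s * X) $$ (i, j) = (\<Sum>l<n. (if l = i then X $$ (i, j) else 0) + (if i = 0 then s * r l * X $$ (l, j) else 0))"
      using that r0 by (subst index_mult_mat_sum[of _ n n _ n]) (auto simp: U_def intro!: sum.cong)
    then show ?thesis
      using that by (simp add: sum.distrib)
  qed
  have UU: "U 1 * U (- 1) = 1\<^sub>m n"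
  proof (rule eq_matI)
    fix i j assume "i < dim_row (1\<^sub>m n :: 'a mat)" "j < dim_col (1\<^sub>m n :: 'a mat)"
    then have ij: "i < n" "j < n" by auto
    have "(\<Sum>l<n. 1 * r l * U (- 1) $$ (l, j)) = (\<Sum>l<n. if l = j then r j else 0)"
      using ij r0 by (intro sum.cong) (auto simp: U_def)
    then show "(U 1 * U (- 1)) $$ (i, j) = 1\<^sub>m n $$ (i, j)"
      using ij r0 by (subst UL[OF Uc ij]) (auto simp: U_def)
  qed (auto simp: U_def)
  have AU: "(K * U 1) $$ (i, j) = K $$ (i, j) + (if i = n - 2 then r j else 0)" if "i < n" "j < n" for i j
  proof -
    have "(K * U 1) $$ (i, j) = (\<Sum>l<n. (if l = j then K $$ (i, j) else 0) + (if l = 0 then K $$ (i, 0) * r j else 0))"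
      using that r0 K by (subst index_mult_mat_sum[of _ n n _ n]) (auto simp: U_def intro!: sum.cong)
    then show ?thesis
      using that K0 by (simp add: sum.distrib)
  qed
  have "null_diagonals n (K * U 1)"
    unfolding null_diagonals_def
  proof safe
    fix e
    \<comment> \<open>The diagonal of offset \<open>e\<close> meets row \<open>n - 2\<close> in
      column \<open>n - 2 - e\<close>; the inner condition guards against truncated subtraction when
      \<open>e = n - 1\<close>.\<close>
    have "(\<Sum>j<n - e. (K * U 1) $$ (j + e, j)) = (\<Sum>j<n - e. K $$ (j + e, j) + (if j = n - 2 - e then (if e \<le> n - 2 then r j else 0) else 0))"
      using n by (intro sum.cong) (auto simp: AU simp del: index_mult_mat(1))
    also have "\<dots> = (\<Sum>j<n - e. K $$ (j + e, j)) + (if e \<le> n - 2 then r (n - 2 - e) else 0)"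
      using n by (auto simp: sum.distrib)
    also have "\<dots> = 0"
    proof -
      consider "e < n - 2" | "e = n - 2" | "e = n - 1" | "e \<ge> n" using n by linarith
      then show ?thesis
      proof cases
        case 1
        then have "n - 2 - (n - 2 - e) = e" "1 \<le> n - 2 - e" "n - 2 - e \<le> n - 2" by auto
        then show ?thesis
          using 1 unfolding r_def by simp
      next
        case 2
        have "n - e = Suc (Suc 0)" using 2 n by auto
        then have "(\<Sum>j<n - e. K $$ (j + e, j)) = K $$ (e, 0) + K $$ (Suc e, 1)"
          by simp
        moreover have "Suc e = n - 1" "K $$ (n - 2, 0) = 1"
          using 2 n K0[of "n - 2"] by auto
        ultimately show ?thesis
          using 2 K1 r0 by simp
      next
        case 3
        have "n - e = Suc 0" using 3 n by auto
        then have "(\<Sum>j<n - e. K $$ (j + e, j)) = K $$ (e, 0)"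
          by simp
        moreover have "K $$ (n - 1, 0) = 0" "\<not> e \<le> n - 2"
          using 3 n K0[of "n - 1"] by auto
        ultimately show ?thesis
          using 3 by simp
      next
        case 4
        then have "\<not> e \<le> n - 2" using n by linarith
        then show ?thesis using 4 by simp
      qed
    qed
    finally show "(\<Sum>j<n - e. (K * U 1) $$ (j + e, j)) = 0" .
  qed (rule mult_carrier_mat[OF K Uc])
  moreover have "null_diagonals n (U (- 1) * W)"
    unfolding null_diagonals_def
  proof safe
    fix e
    \<comment> \<open>Row 0 is the only row that changes, and its only entry on or below the main
      diagonal is \<open>(0, 0)\<close>. That entry is kept because the first column of
      \<open>W\<close> is a unit vector and \<open>r 0 = 0\<close>.\<close>
    have "(\<Sum>l<n. - 1 * r l * W $$ (l, 0)) = 0"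
      using W0 r0 by (intro sum.neutral) auto
    then have "(\<Sum>j<n - e. (U (- 1) * W) $$ (j + e, j)) = (\<Sum>j<n - e. W $$ (j + e, j))"
      by (intro sum.cong) (auto simp: UL[OF Wc] simp del: index_mult_mat(1))
    then show "(\<Sum>j<n - e. (U (- 1) * W) $$ (j + e, j)) = 0"
      using W by (simp add: null_diagonals_def)
  qed (rule mult_carrier_mat[OF Uc Wc])
  moreover have "N = (K * U 1) * (U (- 1) * W)"
  proof -
    have "(K * U 1) * (U (- 1) * W) = K * (U 1 * U (- 1)) * W"
      using K Wc Uc[of 1] Uc[of "- 1"] by (simp add: assoc_mult_mat[of _ n n _ n _ n])
    also have "\<dots> = N * (V * W)"
      using K V N(2) Wc by (simp add: UU K_def assoc_mult_mat[of _ n n _ n _ n])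
    finally show ?thesis
      using N(2) by (simp add: VW)
  qed
  ultimately have "product_of_commutators n N"
    by (intro product_of_commutatorsI null_diagonals_commutator)
  then show ?thesis
    using N(1) product_of_commutators_similar similar_mat_sym by blast
qed

section \<open>Scalar or nonscalar action modulo the plane\<close>

text \<open>Brings an entry at \<open>(i, j)\<close> to \<open>(n - 1, 1)\<close> without disturbing
  the normalised first column. For \<open>n\<close> at least 4 the indices 0, 1,
  \<open>n - 2\<close> and \<open>n - 1\<close> are distinct.\<close>

lemma permutation_moving_two:
  fixes i j n :: nat
  assumes n: "n \<ge> 4" and ij: "i < n" "j < n" "i \<noteq> 0" "j \<noteq> 0" "i \<noteq> n - 2" "j \<noteq> n - 2" "i \<noteq> j"
  obtains \<pi> where "\<pi> permutes {..<n}" "\<pi> 0 = 0" "\<pi> (n - 2) = n - 2" "\<pi> (n - 1) = i" "\<pi> 1 = j"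
proof -
  define \<tau> where "\<tau> = transpose 1 (transpose (n - 1) i j)"
  define \<pi> where "\<pi> = transpose (n - 1) i \<circ> \<tau>"
  have "transpose (n - 1) i j < n"
    using assms by (auto simp: transpose_def)
  then have "\<pi> permutes {..<n}"
    unfolding \<pi>_def \<tau>_def using assms by (intro permutes_compose permutes_swap_id) auto
  moreover have "\<pi> 0 = 0" "\<pi> (n - 2) = n - 2" "\<pi> (n - 1) = i" "\<pi> 1 = j"
    unfolding \<pi>_def \<tau>_def using assms by (auto simp: transpose_def)
  ultimately show thesis
    using that by blast
qed

text \<open>In the second case, \<open>M\<close> acts as the scalar \<open>c\<close> modulo the plane spanned by the basis vectors
  \<open>0\<close> and \<open>n - 2\<close>.\<close>

lemma nonscalar_or_scalar_quotient:
  fixes M :: "'a::division_ring mat"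
  assumes M: "M \<in> carrier_mat n n" and n: "n \<ge> 3"
    and M0: "\<And>i. i < n \<Longrightarrow> M $$ (i, 0) = (if i = n - 2 then 1 else 0)"
  obtains (nonscalar) N where "similar_mat N M" "N \<in> carrier_mat n n"
      "\<And>i. i < n \<Longrightarrow> N $$ (i, 0) = (if i = n - 2 then 1 else 0)" "N $$ (n - 1, 1) \<noteq> 0"
    | (scalar) c where "\<And>i j. i < n \<Longrightarrow> j < n \<Longrightarrow> i \<noteq> 0 \<Longrightarrow> i \<noteq> n - 2 \<Longrightarrow> j \<noteq> 0 \<Longrightarrow>
      M $$ (i, j) = (if i = j then c else 0)"
\<comment> \<open>For \<open>n = 3\<close> the indices 1 and \<open>n - 2\<close> coincide, so the
  entry \<open>(2, 1)\<close> alone decides.\<close>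
proof (cases "n = 3")
  case True
  show thesis
  proof (cases "M $$ (2, 1) = 0")
    case False
    then show thesis
      using nonscalar[of M] similar_mat_refl[OF M] M M0 True by auto
  next
    case 0: True
    show thesis
    proof (rule scalar[of "M $$ (2, 2)"])
      fix i j assume "i < n" "j < n" "i \<noteq> 0" "i \<noteq> n - 2" "j \<noteq> 0"
      then have "i = 2" "j = 1 \<or> j = 2"
        using True by auto
      then show "M $$ (i, j) = (if i = j then M $$ (2, 2) else 0)"
        using 0 by auto
    qed
  qed
next
  case False
  then have n4: "n \<ge> 4" using n by simp
  define P where "P X \<longleftrightarrow> similar_mat X M \<and> X \<in> carrier_mat n n \<and>
    (\<forall>i<n. X $$ (i, 0) = (if i = n - 2 then 1 else 0))" for X
  have PM: "P M"
    using M M0 similar_mat_refl[OF M] by (simp add: P_def)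
  have step: thesis if X: "P X" and ij: "i < n" "j < n" "i \<noteq> 0" "j \<noteq> 0" "i \<noteq> n - 2" "j \<noteq> n - 2" "i \<noteq> j"
    and nz: "X $$ (i, j) \<noteq> 0" for X i j
  proof -
    obtain \<pi> where pi: "\<pi> permutes {..<n}" "\<pi> 0 = 0" "\<pi> (n - 2) = n - 2" "\<pi> (n - 1) = i" "\<pi> 1 = j"
      using permutation_moving_two[OF n4 ij] by metis
    have Xc: "X \<in> carrier_mat n n" and XM: "similar_mat X M"
      using X by (auto simp: P_def)
    have lt: "\<pi> i < n" if "i < n" for i
      using permutes_in_image[OF pi(1)] that by simp
    have eq: "\<pi> i = n - 2 \<longleftrightarrow> i = n - 2" for i
      using pi(3) permutes_inj[OF pi(1)] by (metis injD)
    let ?N = "mat n n (\<lambda>(i, j). X $$ (\<pi> i, \<pi> j))"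
    show thesis
    proof (rule nonscalar[of ?N])
      show "similar_mat ?N M"
        using similar_mat_permute[OF Xc pi(1)] XM similar_mat_trans by blast
      show "?N $$ (i, 0) = (if i = n - 2 then 1 else 0)" if "i < n" for i
        using that n4 X lt eq pi(2) by (simp add: P_def)
      show "?N $$ (n - 1, 1) \<noteq> 0"
        using n4 pi nz by simp
    qed simp
  qed
  \<comment> \<open>Since \<open>M\<close> has the entry 0 at \<open>(k, 0)\<close>, such a
    transvection leaves the first column alone. The index \<open>l\<close> may be
    \<open>n - 2\<close>, which brings entries of that column into column \<open>k\<close>.\<close>
  have transv: "\<exists>N. P N \<and> N $$ (i, k) = M $$ (i, k) + M $$ (i, l) - (if i = l then M $$ (k, k) + M $$ (k, l) else 0)"
    if kl: "i < n" "k < n" "l < n" "k \<noteq> l" "k \<noteq> 0" "k \<noteq> n - 2" for i k l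
  proof -
    obtain N where N: "similar_mat N M" "N \<in> carrier_mat n n"
      "\<And>i j. i < n \<Longrightarrow> j < n \<Longrightarrow> N $$ (i, j) = M $$ (i, j) + (if j = k then M $$ (i, l) else 0)
      - (if i = l then M $$ (k, j) + (if j = k then M $$ (k, l) else 0) else 0)"
      using similar_transvection[OF M kl(2-4)] by metis
    have "P N"
      using kl N n4 M0 by (auto simp: P_def)
    then show ?thesis
      using N(3)[of i k] kl by auto
  qed
  \<comment> \<open>These indices form a basis modulo the plane; 1 and \<open>n - 1\<close> are
    among them, so there are at least two.\<close>
  let ?I = "{i. i < n \<and> i \<noteq> 0 \<and> i \<noteq> n - 2}"
  show thesis
  proof (cases "\<exists>i\<in>?I. \<exists>j\<in>?I. i \<noteq> j \<and> M $$ (i, j) \<noteq> 0")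
    case True
    then show thesis
      using step[OF PM] by blast
  next
    case False
    then have off: "M $$ (i, j) = 0" if "i \<in> ?I" "j \<in> ?I" "i \<noteq> j" for i j
      using that by blast
    show thesis
    proof (cases "\<exists>i\<in>?I. M $$ (i, n - 2) \<noteq> 0")
      case True
      then obtain i where i: "i \<in> ?I" "M $$ (i, n - 2) \<noteq> 0" by blast
      define j where "j = (if i = 1 then n - 1 else 1)"
      have j: "j \<in> ?I" "j \<noteq> i"
        using n4 by (auto simp: j_def)
      then obtain N where "P N" "N $$ (i, j) = M $$ (i, n - 2)"
        using transv[of i j "n - 2"] off[of i j] i n4 by auto
      then show thesis
        using step[of N i j] i j by simp
    next
      case False
      then have col: "M $$ (i, n - 2) = 0" if "i \<in> ?I" for i
        using that by blast
      show thesis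
      proof (cases "\<exists>i\<in>?I. M $$ (i, i) \<noteq> M $$ (1, 1)")
        case True
        then obtain i where i: "i \<in> ?I" "M $$ (i, i) \<noteq> M $$ (1, 1)" by blast
        then have j: "1 \<in> ?I" "i \<noteq> 1"
          using n4 by auto
        then obtain N where "P N" "N $$ (i, 1) = M $$ (i, i) - M $$ (1, 1)"
          using transv[of i 1 i] off[of i 1] off[of 1 i] i by auto
        then show thesis
          using step[of N i 1] i j by simp
      next
        case False
        then have diag: "M $$ (i, i) = M $$ (1, 1)" if "i \<in> ?I" for i
          using that by blast
        show thesis
        proof (rule scalar[of "M $$ (1, 1)"])
          fix i j assume "i < n" "j < n" "i \<noteq> 0" "i \<noteq> n - 2" "j \<noteq> 0"
          then have i: "i \<in> ?I" "j = n - 2 \<or> j \<in> ?I"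
            by auto
          then show "M $$ (i, j) = (if i = j then M $$ (1, 1) else 0)"
            using off[of i j] col[OF i(1)] diag[OF i(1)] \<open>i \<noteq> n - 2\<close> by auto
        qed
      qed
    qed
  qed
qed

section \<open>Scalar action modulo the plane, size other than three\<close>

lemma mat_2_carrier: "mat_of_rows_list 2 [r, s] \<in> carrier_mat 2 2"
  by (simp add: mat_of_rows_list_def numeral_2_eq_2)

lemma mat_2_mult:
  "mat_of_rows_list 2 [[a, b], [c, d]] * mat_of_rows_list 2 [[a', b'], [c', d']] =
    mat_of_rows_list 2 [[a * a' + b * c', a * b' + b * d'], [c * a' + d * c', c * b' + d * d']]"
  by (intro eq_matI) (auto simp: mat_of_rows_list_def scalar_prod_def less_Suc_eq numeral_2_eq_2)

text \<open>Bracketing with the idempotent \<open>diag(1, 0)\<close> keeps the upper right entry,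
  negates the lower left one and kills the diagonal.\<close>

lemma commutator_2:
  fixes b c :: "'a::ring_1"
  shows "mat_of_rows_list 2 [[0, b], [c, 0]] \<in> commutators_mat 2"
proof -
  have "mat_of_rows_list 2 [[0, b], [c, 0]] =
    mat_of_rows_list 2 [[1, 0], [0, 0]] * mat_of_rows_list 2 [[0, b], [- c, 0]]
      - mat_of_rows_list 2 [[0, b], [- c, 0]] * mat_of_rows_list 2 [[1, 0], [0, 0]]"
    unfolding mat_2_mult
    by (intro eq_matI) (auto simp: mat_of_rows_list_def less_Suc_eq numeral_2_eq_2)
  then show ?thesis
    using commutators_matI[OF mat_2_carrier mat_2_carrier] by metis
qed

text \<open>The companion block is \<open>?A1 * ?B1\<close> and the scalar block is \<open>c\<close>
  times the transpose of \<open>R\<close>, times \<open>R\<close>. The block \<open>Y\<close> is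
  absorbed by solving \<open>?A1 * Z = Y\<close>, which is possible because the entry
  \<open>(0, 1)\<close> of \<open>M\<close> is invertible. Excluding \<open>n = 3\<close> ensures
  that \<open>R\<close> exists.\<close>

lemma product_of_commutators_scalar_quotient:
  fixes M :: "'a::division_ring mat"
  assumes M: "M \<in> carrier_mat n n" and n: "n \<ge> 2" "n \<noteq> 3"
    and M0: "\<And>i. i < n \<Longrightarrow> M $$ (i, 0) = (if i = 1 then 1 else 0)"
    and c: "\<And>i j. 2 \<le> i \<Longrightarrow> i < n \<Longrightarrow> j < n \<Longrightarrow> M $$ (i, j) = (if i = j then c else 0)"
    and x: "M $$ (0, 1) \<noteq> 0"
  shows "product_of_commutators n M"
proof -
  define q where "q = n - 2"
  have nq: "n = 2 + q" and q: "q \<noteq> 1"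
    using n by (auto simp: q_def)
  obtain R :: "'a mat" where R: "null_diagonals q R" "transpose_mat R * R = 1\<^sub>m q"
    using exists_orthogonal_null_diagonals[OF q] by blast
  note Rc = null_diagonals_carrier[OF R(1)]
  let ?x = "M $$ (0, 1)"
  let ?A1 = "mat_of_rows_list 2 [[0, - ?x], [1, 0]]"
  let ?B1 = "mat_of_rows_list 2 [[1, M $$ (1, 1)], [0, - 1]]"
  define Z where "Z = mat 2 q (\<lambda>(i, j). if i = 0 then M $$ (1, 2 + j) else - (inverse ?x * M $$ (0, 2 + j)))"
  define Y where "Y = mat 2 q (\<lambda>(i, j). M $$ (i, 2 + j))"
  have A1: "?A1 \<in> carrier_mat 2 2" "?B1 \<in> carrier_mat 2 2"
    by (rule mat_2_carrier)+
  have Zc: "Z \<in> carrier_mat 2 q" and Yc: "Y \<in> carrier_mat 2 q"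
    by (auto simp: Z_def Y_def)
  let ?A = "four_block_mat ?A1 (0\<^sub>m 2 q) (0\<^sub>m q 2) (c \<cdot>\<^sub>m transpose_mat R)"
  let ?B = "four_block_mat ?B1 Z (0\<^sub>m q 2) R"
  have AZ: "?A1 * Z = Y"
    using x by (intro eq_matI) (auto simp: Z_def Y_def mat_of_rows_list_def scalar_prod_def less_Suc_eq numeral_2_eq_2 mult.assoc[symmetric])
  have "?A * ?B = four_block_mat (mat_of_rows_list 2 [[0, ?x], [1, M $$ (1, 1)]]) Y (0\<^sub>m q 2) (c \<cdot>\<^sub>m 1\<^sub>m q)"
    using A1 Zc Yc Rc R(2)
    by (subst mult_four_block_mat[of _ 2 2 _ q _ q _ _ 2 _ q])
      (simp_all add: AZ mat_2_mult smult_mult_mat[of _ q q _ q] right_add_zero_mat[OF mat_2_carrier]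
        left_mult_zero_mat[OF mat_2_carrier] del: One_nat_def)
  also have "\<dots> = M"
  proof (rule eq_matI)
    fix i j assume "i < dim_row M" "j < dim_col M"
    then have ij: "i < 2 + q" "j < 2 + q" using M nq by auto
    have shift: "Suc (Suc (j - 2)) = j" if "2 \<le> j" for j
      using that by simp
    consider "i = 0" "j = 0" | "i = 0" "j = 1" | "i = 1" "j = 0" | "i = 1" "j = 1" | "i < 2" "j \<ge> 2" | "i \<ge> 2" "j < 2" | "i \<ge> 2" "j \<ge> 2"
      by linarith
    then show "four_block_mat (mat_of_rows_list 2 [[0, ?x], [1, M $$ (1, 1)]]) Y (0\<^sub>m q 2) (c \<cdot>\<^sub>m 1\<^sub>m q) $$ (i, j) = M $$ (i, j)"
      using ij M0 c nq shift[of j] by cases (auto simp: mat_of_rows_list_def Y_def)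
  qed (use M nq in \<open>auto simp: mat_of_rows_list_def\<close>)
  finally have "M = ?A * ?B" ..
  moreover have "transpose_mat (c \<cdot>\<^sub>m transpose_mat R) = c \<cdot>\<^sub>m R"
    using Rc by (intro eq_matI) auto
  then have "?A \<in> commutators_mat n"
    unfolding nq
    by (intro commutators_mat_four_block commutator_2 transpose_null_diagonals_commutator)
      (simp add: null_diagonals_smult[OF R(1)])
  moreover have "?B \<in> commutators_mat n"
    unfolding nq by (intro null_diagonals_commutator null_diagonals_four_block null_diagonals_2 R(1) Zc) simp
  ultimately show ?thesis
    by (metis product_of_commutatorsI)
qed

section \<open>Matrices of size three\<close>

lemma mat_3_carrier: "mat_of_rows_list 3 [r, s, t] \<in> carrier_mat 3 3"
  by (simp add: mat_of_rows_list_def numeral_3_eq_3)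

lemma mat_3_index:
  "mat_of_rows_list 3 [[a, b, c], [d, e, f], [g, h, i]] $$ (0, 0) = a"
  "mat_of_rows_list 3 [[a, b, c], [d, e, f], [g, h, i]] $$ (0, 1) = b"
  "mat_of_rows_list 3 [[a, b, c], [d, e, f], [g, h, i]] $$ (0, Suc 0) = b"
  "mat_of_rows_list 3 [[a, b, c], [d, e, f], [g, h, i]] $$ (0, 2) = c"
  "mat_of_rows_list 3 [[a, b, c], [d, e, f], [g, h, i]] $$ (1, 0) = d"
  "mat_of_rows_list 3 [[a, b, c], [d, e, f], [g, h, i]] $$ (1, 1) = e"
  "mat_of_rows_list 3 [[a, b, c], [d, e, f], [g, h, i]] $$ (1, 2) = f"
  "mat_of_rows_list 3 [[a, b, c], [d, e, f], [g, h, i]] $$ (Suc 0, 0) = d"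
  "mat_of_rows_list 3 [[a, b, c], [d, e, f], [g, h, i]] $$ (Suc 0, Suc 0) = e"
  "mat_of_rows_list 3 [[a, b, c], [d, e, f], [g, h, i]] $$ (Suc 0, 2) = f"
  "mat_of_rows_list 3 [[a, b, c], [d, e, f], [g, h, i]] $$ (2, 0) = g"
  "mat_of_rows_list 3 [[a, b, c], [d, e, f], [g, h, i]] $$ (2, 1) = h"
  "mat_of_rows_list 3 [[a, b, c], [d, e, f], [g, h, i]] $$ (2, Suc 0) = h"
  "mat_of_rows_list 3 [[a, b, c], [d, e, f], [g, h, i]] $$ (2, 2) = i"
  by (simp_all add: mat_of_rows_list_def)

lemma mat_3_eq:
  assumes "M \<in> carrier_mat 3 3"
  shows "M = mat_of_rows_list 3 [[M $$ (0, 0), M $$ (0, 1), M $$ (0, 2)],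
    [M $$ (1, 0), M $$ (1, 1), M $$ (1, 2)], [M $$ (2, 0), M $$ (2, 1), M $$ (2, 2)]]" (is "M = ?N")
proof (rule eq_matI)
  fix i j assume "i < dim_row ?N" "j < dim_col ?N"
  then have "i = 0 \<or> i = 1 \<or> i = 2" "j = 0 \<or> j = 1 \<or> j = 2"
    by (auto simp: mat_of_rows_list_def)
  then show "M $$ (i, j) = ?N $$ (i, j)"
    by (elim disjE) (simp_all add: mat_3_index)
qed (use assms in \<open>auto simp: mat_of_rows_list_def\<close>)

lemma mat_3_mult:
  "mat_of_rows_list 3 [[a, b, c], [d, e, f], [g, h, i]] * mat_of_rows_list 3 [[a', b', c'], [d', e', f'], [g', h', i']] =
    mat_of_rows_list 3 [[a * a' + b * d' + c * g', a * b' + b * e' + c * h', a * c' + b * f' + c * i'],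
      [d * a' + e * d' + f * g', d * b' + e * e' + f * h', d * c' + e * f' + f * i'],
      [g * a' + h * d' + i * g', g * b' + h * e' + i * h', g * c' + h * f' + i * i']]" (is "?A * ?B = ?C")
proof -
  have AB: "?A * ?B \<in> carrier_mat 3 3"
    by (rule mult_carrier_mat[OF mat_3_carrier mat_3_carrier])
  have S: "(\<Sum>k<3. f k) = f 0 + f 1 + f 2" for f :: "nat \<Rightarrow> 'a"
    by (simp add: eval_nat_numeral)
  have lt: "0 < (3::nat)" "1 < (3::nat)" "2 < (3::nat)"
    by simp_all
  show ?thesis
    by (subst mat_3_eq[OF AB], simp only: index_mult_mat_sum[OF mat_3_carrier mat_3_carrier] S mat_3_index lt)
qed

lemma one_mat_3: "1\<^sub>m 3 = mat_of_rows_list 3 [[1, 0, 0], [0, 1, 0], [0, 0, 1]]"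
  by (subst mat_3_eq[OF one_carrier_mat]) simp

text \<open>The criterion of vanishing diagonal sums for the basis reordered as \<open>p\<close>,
  \<open>q\<close>, \<open>r\<close>.\<close>

lemma commutator_3:
  fixes A :: "'a::ring_1 mat"
  assumes A: "A \<in> carrier_mat 3 3" and pqr: "distinct [p, q, r]" "p < 3" "q < 3" "r < 3"
    and z: "A $$ (p, p) + A $$ (q, q) + A $$ (r, r) = 0" "A $$ (q, p) + A $$ (r, q) = 0" "A $$ (r, p) = 0"
  shows "A \<in> commutators_mat 3"
proof -
  define \<pi> where "\<pi> i = (if i = 0 then p else if i = 1 then q else if i = 2 then r else i)" for i :: nat
  have "inj_on \<pi> {..<3}" "\<pi> ` {..<3} \<subseteq> {..<3}"
    using pqr by (auto simp: inj_on_def \<pi>_def)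
  then have "bij_betw \<pi> {..<3} {..<3}"
    by (simp add: bij_betw_def endo_inj_surj)
  then have "\<pi> permutes {..<3}"
    by (rule bij_imp_permutes) (simp add: \<pi>_def)
  then have "similar_mat A (mat 3 3 (\<lambda>(i, j). A $$ (\<pi> i, \<pi> j)))" (is "similar_mat A ?N")
    using similar_mat_permute[OF A] similar_mat_sym by blast
  moreover have "null_diagonals 3 ?N"
    by (subst mat_3_eq[OF mat_carrier]) (use z in \<open>simp add: \<pi>_def null_diagonals_3\<close>)
  ultimately show ?thesis
    using commutators_mat_similar null_diagonals_commutator by blast
qed

text \<open>The scalar block has size 1, where no signed permutation has trace 0. The element
  \<open>a\<close> supplies instead the invertible diagonal \<open>1, -a, a - 1\<close> of trace
  0.\<close>

lemma product_of_commutators_scalar_quotient_3: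
  fixes x y d z c a :: "'a::division_ring"
  assumes x: "x \<noteq> 0" and a: "a \<noteq> 0" "a \<noteq> 1"
  shows "product_of_commutators 3 (mat_of_rows_list 3 [[0, x, y], [1, d, z], [0, 0, c]])"
    (is "product_of_commutators 3 ?M")
proof -
  define b where "b = a - 1"
  define u where "u = - inverse a"
  define v where "v = inverse b"
  have b: "b \<noteq> 0" "u * a = - 1" "v * b = 1"
    using a by (auto simp: b_def u_def v_def)
  \<comment> \<open>\<open>q\<close> and \<open>r\<close> are the entries \<open>(0, 1)\<close> and
    \<open>(2, 2)\<close> of \<open>?M * ?U\<close>. The entries \<open>w\<close>,
    \<open>w''\<close> and \<open>w'\<close> solve the linear equations that make its entries
    \<open>(1, 1)\<close>, \<open>(0, 2)\<close> and \<open>(1, 2)\<close> equal to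
    \<open>- r\<close>, \<open>- r\<close> and \<open>1 + q\<close>.\<close>
  define q where "q = x * u"
  define r where "r = c * v"
  define w where "w = - r - d * u"
  define w'' where "w'' = inverse x * (- r - y * v)"
  define w' where "w' = 1 + q - d * w'' - z * v"
  have xw: "x * w'' = - r - y * v"
    using x by (simp add: w''_def mult.assoc[symmetric])
  let ?U = "mat_of_rows_list 3 [[1, w, w'], [0, u, w''], [0, 0, v]]"
  let ?B = "mat_of_rows_list 3 [[1, w * a, - (w * a * w'' * b) - w' * b], [0, - a, a * w'' * b], [0, 0, b]]"
  \<comment> \<open>The upper triangular \<open>?U\<close> has inverse \<open>?B\<close> of trace \<open>0\<close>; its entries are chosen so that the
    conjugate \<open>?A'\<close> of \<open>?A = ?M * ?U\<close> has vanishing diagonal sums.\<close>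
  let ?A = "mat_of_rows_list 3 [[0, q, - r], [1, - r, 1 + q], [0, 0, r]]"
  let ?A' = "mat_of_rows_list 3 [[r, q, - r], [- q, - r, 1 + q], [0, q, 0]]"
  have "?M * ?U = ?A"
    by (simp add: mat_3_mult xw) (simp add: q_def r_def w_def w'_def)
  moreover have "?U * ?B = 1\<^sub>m 3"
    using b by (simp add: mat_3_mult one_mat_3 mult.assoc[symmetric])
  moreover have "?M * (?U * ?B) = ?M * ?U * ?B"
    by (rule assoc_mult_mat[OF mat_3_carrier mat_3_carrier mat_3_carrier, symmetric])
  ultimately have M: "?M = ?A * ?B"
    by (simp add: right_mult_one_mat[OF mat_3_carrier])
  \<comment> \<open>The first subdiagonal of \<open>?A\<close> sums to 1; a shear mixing the basis
    vectors 0 and 2 changes this sum to \<open>- q + q\<close>.\<close>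
  have "similar_mat ?A ?A'"
  proof (rule similar_matI[of _ _ "mat_of_rows_list 3 [[1, 0, 0], [0, 1, 0], [- 1, 0, 1]]"
        "mat_of_rows_list 3 [[1, 0, 0], [0, 1, 0], [1, 0, 1]]" 3])
  qed (simp_all add: mat_3_carrier mat_3_mult one_mat_3)
  moreover have "null_diagonals 3 ?A'"
    by (rule null_diagonals_3) simp_all
  ultimately have "?A \<in> commutators_mat 3"
    using commutators_mat_similar null_diagonals_commutator by blast
  moreover have "?B \<in> commutators_mat 3"
    by (intro null_diagonals_commutator null_diagonals_3) (simp_all add: b_def)
  ultimately show ?thesis
    using M by (metis product_of_commutatorsI)
qed

lemma product_of_commutators_kernel_3:
  fixes M :: "'a::division_ring mat"
  assumes M: "M \<in> carrier_mat 3 3"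
    and z: "\<And>i. i < 3 \<Longrightarrow> M $$ (i, 0) * s + M $$ (i, 1) * t + M $$ (i, 2) = 0"
  shows "product_of_commutators 3 M"
proof -
  let ?v = "\<lambda>l::nat. if l = 0 then s else if l = 1 then t else 1"
  have "(\<Sum>l<3. M $$ (i, l) * ?v l) = 0" if "i < 3" for i
    using z[OF that] by (simp add: eval_nat_numeral)
  then show ?thesis
    by (intro product_of_commutators_kernel[OF M, where k = 2 and v = ?v]) simp_all
qed

text \<open>For \<open>x = 0\<close> the vector \<open>(- a, - b, 1)\<close> lies in the kernel.
  Otherwise \<open>x = 1\<close>, and one factorisation is given for each pair \<open>a\<close>,
  \<open>b\<close>, whose values are the digits in the labels.\<close>

lemma product_of_commutators_companion_F2:
  fixes x a b :: "'a::division_ring"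
  assumes F2: "\<And>t::'a. t = 0 \<or> t = 1"
  shows "product_of_commutators 3 (mat_of_rows_list 3 [[0, 0, x], [1, 0, a], [0, 1, b]])"
proof -
  \<comment> \<open>As -1 is not 0, it must be 1; the trace conditions below hold in characteristic
    2.\<close>
  have two: "(2::'a) = 0"
    using F2[of "- 1"] by (metis add.right_inverse one_add_one neg_equal_0_iff_equal zero_neq_one)
  \<comment> \<open>The factorisations were found by exhaustive search.\<close>
  have c00: "product_of_commutators 3 (mat_of_rows_list 3 [[0, 0, 1], [1, 0, 0], [0, 1, 0]] :: 'a mat)"
    by (rule product_of_commutatorsI[OF
          commutator_3[of "mat_of_rows_list 3 [[0, 1, 0], [1, 1, 0], [0, 1, 1]]" 0 1 2]
          commutator_3[of "mat_of_rows_list 3 [[1, 0, 1], [0, 0, 1], [0, 1, 1]]" 1 2 0]])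
      (simp_all add: mat_3_carrier mat_3_mult mat_3_index two)
  have c01: "product_of_commutators 3 (mat_of_rows_list 3 [[0, 0, 1], [1, 0, 0], [0, 1, 1]] :: 'a mat)"
    by (rule product_of_commutatorsI[OF
          commutator_3[of "mat_of_rows_list 3 [[0, 1, 1], [1, 0, 1], [0, 1, 0]]" 0 1 2]
          commutator_3[of "mat_of_rows_list 3 [[1, 1, 0], [0, 1, 1], [0, 1, 0]]" 2 1 0]])
      (simp_all add: mat_3_carrier mat_3_mult mat_3_index two)
  have c10: "product_of_commutators 3 (mat_of_rows_list 3 [[0, 0, 1], [1, 0, 1], [0, 1, 0]] :: 'a mat)"
    by (rule product_of_commutatorsI[OF
          commutator_3[of "mat_of_rows_list 3 [[1, 0, 1], [0, 1, 1], [1, 0, 0]]" 0 2 1]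
          commutator_3[of "mat_of_rows_list 3 [[0, 1, 0], [1, 1, 0], [0, 1, 1]]" 0 1 2]])
      (simp_all add: mat_3_carrier mat_3_mult mat_3_index two)
  have c11: "product_of_commutators 3 (mat_of_rows_list 3 [[0, 0, 1], [1, 0, 1], [0, 1, 1]] :: 'a mat)"
    by (rule product_of_commutatorsI[OF
          commutator_3[of "mat_of_rows_list 3 [[0, 1, 1], [1, 0, 0], [0, 1, 0]]" 0 1 2]
          commutator_3[of "mat_of_rows_list 3 [[1, 0, 1], [0, 1, 1], [0, 1, 0]]" 1 2 0]])
      (simp_all add: mat_3_carrier mat_3_mult mat_3_index two)
  show ?thesis
  proof (cases "x = 0")
    case True
    show ?thesis
    proof (rule product_of_commutators_kernel_3[OF mat_3_carrier, of _ _ _ "- a" "- b"])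
      fix i :: nat assume "i < 3"
      then have "i = 0 \<or> i = 1 \<or> i = 2" by linarith
      then show "mat_of_rows_list 3 [[0, 0, x], [1, 0, a], [0, 1, b]] $$ (i, 0) * - a
        + mat_of_rows_list 3 [[0, 0, x], [1, 0, a], [0, 1, b]] $$ (i, 1) * - b
        + mat_of_rows_list 3 [[0, 0, x], [1, 0, a], [0, 1, b]] $$ (i, 2) = 0"
        using True by (elim disjE) (simp_all add: mat_3_index)
    qed
  next
    case False
    then have "x = 1" using F2 by blast
    then show ?thesis
      using F2[of a] F2[of b] c00 c01 c10 c11 by auto
  qed
qed

text \<open>For \<open>c = 0\<close> the vector \<open>(d * y - z, - y, 1)\<close> lies in the
  kernel. For \<open>c = 1\<close> the labels list the values of \<open>y\<close>, \<open>d\<close>,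
  \<open>z\<close>.\<close>

lemma product_of_commutators_scalar_quotient_F2:
  fixes y d z c :: "'a::division_ring"
  assumes F2: "\<And>t::'a. t = 0 \<or> t = 1"
  shows "product_of_commutators 3 (mat_of_rows_list 3 [[0, 1, y], [1, d, z], [0, 0, c]])"
proof -
  have two: "(2::'a) = 0"
    using F2[of "- 1"] by (metis add.right_inverse one_add_one neg_equal_0_iff_equal zero_neq_one)
  \<comment> \<open>The factorisations were found by exhaustive search.\<close>
  have b000: "product_of_commutators 3 (mat_of_rows_list 3 [[0, 1, 0], [1, 0, 0], [0, 0, 1]] :: 'a mat)"
    by (rule product_of_commutatorsI[OF
          commutator_3[of "mat_of_rows_list 3 [[0, 0, 1], [0, 1, 1], [1, 1, 1]]" 0 2 1]
          commutator_3[of "mat_of_rows_list 3 [[1, 0, 1], [1, 1, 0], [0, 1, 0]]" 0 1 2]])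
      (simp_all add: mat_3_carrier mat_3_mult mat_3_index two)
  have b001: "product_of_commutators 3 (mat_of_rows_list 3 [[0, 1, 0], [1, 0, 1], [0, 0, 1]] :: 'a mat)"
    by (rule product_of_commutatorsI[OF
          commutator_3[of "mat_of_rows_list 3 [[0, 1, 1], [1, 0, 0], [0, 1, 0]]" 0 1 2]
          commutator_3[of "mat_of_rows_list 3 [[1, 0, 1], [0, 0, 1], [0, 1, 1]]" 1 2 0]])
      (simp_all add: mat_3_carrier mat_3_mult mat_3_index two)
  have b010: "product_of_commutators 3 (mat_of_rows_list 3 [[0, 1, 0], [1, 1, 0], [0, 0, 1]] :: 'a mat)"
    by (rule product_of_commutatorsI[OF
          commutator_3[of "mat_of_rows_list 3 [[0, 0, 1], [0, 1, 1], [1, 0, 1]]" 0 2 1]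
          commutator_3[of "mat_of_rows_list 3 [[0, 1, 1], [1, 0, 0], [0, 1, 0]]" 0 1 2]])
      (simp_all add: mat_3_carrier mat_3_mult mat_3_index two)
  have b011: "product_of_commutators 3 (mat_of_rows_list 3 [[0, 1, 0], [1, 1, 1], [0, 0, 1]] :: 'a mat)"
    by (rule product_of_commutatorsI[OF
          commutator_3[of "mat_of_rows_list 3 [[1, 0, 0], [1, 1, 1], [0, 1, 0]]" 0 1 2]
          commutator_3[of "mat_of_rows_list 3 [[0, 1, 0], [0, 0, 1], [1, 0, 0]]" 0 2 1]])
      (simp_all add: mat_3_carrier mat_3_mult mat_3_index two)
  have b100: "product_of_commutators 3 (mat_of_rows_list 3 [[0, 1, 1], [1, 0, 0], [0, 0, 1]] :: 'a mat)"
    by (rule product_of_commutatorsI[OF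
          commutator_3[of "mat_of_rows_list 3 [[0, 0, 1], [1, 0, 0], [1, 1, 0]]" 1 2 0]
          commutator_3[of "mat_of_rows_list 3 [[1, 0, 0], [1, 0, 1], [0, 1, 1]]" 0 1 2]])
      (simp_all add: mat_3_carrier mat_3_mult mat_3_index two)
  have b101: "product_of_commutators 3 (mat_of_rows_list 3 [[0, 1, 1], [1, 0, 1], [0, 0, 1]] :: 'a mat)"
    by (rule product_of_commutatorsI[OF
          commutator_3[of "mat_of_rows_list 3 [[0, 0, 1], [1, 0, 0], [0, 1, 0]]" 0 1 2]
          commutator_3[of "mat_of_rows_list 3 [[1, 0, 1], [0, 0, 1], [0, 1, 1]]" 1 2 0]])
      (simp_all add: mat_3_carrier mat_3_mult mat_3_index two)
  have b110: "product_of_commutators 3 (mat_of_rows_list 3 [[0, 1, 1], [1, 1, 0], [0, 0, 1]] :: 'a mat)"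
    by (rule product_of_commutatorsI[OF
          commutator_3[of "mat_of_rows_list 3 [[0, 0, 1], [1, 0, 0], [0, 1, 0]]" 0 1 2]
          commutator_3[of "mat_of_rows_list 3 [[1, 1, 0], [0, 0, 1], [0, 1, 1]]" 2 1 0]])
      (simp_all add: mat_3_carrier mat_3_mult mat_3_index two)
  have b111: "product_of_commutators 3 (mat_of_rows_list 3 [[0, 1, 1], [1, 1, 1], [0, 0, 1]] :: 'a mat)"
    by (rule product_of_commutatorsI[OF
          commutator_3[of "mat_of_rows_list 3 [[1, 0, 1], [0, 1, 1], [1, 0, 0]]" 0 2 1]
          commutator_3[of "mat_of_rows_list 3 [[0, 0, 1], [1, 0, 1], [0, 1, 0]]" 0 1 2]])
      (simp_all add: mat_3_carrier mat_3_mult mat_3_index two)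
  show ?thesis
  proof (cases "c = 0")
    case True
    show ?thesis
    proof (rule product_of_commutators_kernel_3[OF mat_3_carrier, of _ _ _ "d * y - z" "- y"])
      fix i :: nat assume "i < 3"
      then have "i = 0 \<or> i = 1 \<or> i = 2" by linarith
      then show "mat_of_rows_list 3 [[0, 1, y], [1, d, z], [0, 0, c]] $$ (i, 0) * (d * y - z)
        + mat_of_rows_list 3 [[0, 1, y], [1, d, z], [0, 0, c]] $$ (i, 1) * - y
        + mat_of_rows_list 3 [[0, 1, y], [1, d, z], [0, 0, c]] $$ (i, 2) = 0"
        using True by (elim disjE) (simp_all add: mat_3_index)
    qed
  next
    case False
    then have "c = 1" using F2 by blast
    then show ?thesis
      using F2[of y] F2[of d] F2[of z] b000 b001 b010 b011 b100 b101 b110 b111 by auto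
  qed
qed

section \<open>Assembling the cases\<close>

lemma product_of_commutators_scalar_quotient_cases:
  fixes M :: "'a::division_ring mat"
  assumes M: "M \<in> carrier_mat n n" and n: "n \<ge> 2"
    and M0: "\<And>i. i < n \<Longrightarrow> M $$ (i, 0) = (if i = 1 then 1 else 0)"
    and c: "\<And>i j. 2 \<le> i \<Longrightarrow> i < n \<Longrightarrow> j < n \<Longrightarrow> M $$ (i, j) = (if i = j then c else 0)"
  shows "product_of_commutators n M"
proof (cases "M $$ (0, 1) = 0")
  case True
  \<comment> \<open>If the entry \<open>(0, 1)\<close> vanishes, column 1 is column 0 times
    \<open>M $$ (1, 1)\<close> on the right, and \<open>?v\<close> records this dependence.\<close>
  let ?v = "\<lambda>l. if l = 0 then - M $$ (1, 1) else if l = 1 then 1 else 0"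
  have "(\<Sum>l<n. M $$ (i, l) * ?v l) = 0" if "i < n" for i
  proof -
    have "(\<Sum>l<n. M $$ (i, l) * ?v l) =
      (\<Sum>l<n. (if l = 0 then M $$ (i, 0) * - M $$ (1, 1) else 0) + (if l = 1 then M $$ (i, 1) else 0))"
      by (intro sum.cong) auto
    also have "\<dots> = M $$ (i, 0) * - M $$ (1, 1) + M $$ (i, 1)"
      using n by (simp add: sum.distrib)
    also have "\<dots> = 0"
    proof -
      consider "i = 0" | "i = 1" | "i \<ge> 2" by linarith
      then show ?thesis
        using M0[OF that] c[OF _ that, of 1] n True by cases auto
    qed
    finally show ?thesis .
  qed
  then show ?thesis
    using n by (intro product_of_commutators_kernel[OF M, where k = 1 and v = ?v]) simp_all
next
  case x: False
  show ?thesis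
  proof (cases "n = 3")
    case False
    then show ?thesis
      using product_of_commutators_scalar_quotient[OF M n _ M0 c x] by blast
  next
    case True
    have "M $$ (0, 0) = 0" "M $$ (1, 0) = 1" "M $$ (2, 0) = 0" "M $$ (2, 1) = 0" "M $$ (2, 2) = c"
      using M0[of 0] M0[of 1] M0[of 2] c[of 2 1] c[of 2 2] True by simp_all
    then have eq: "M = mat_of_rows_list 3 [[0, M $$ (0, 1), M $$ (0, 2)], [1, M $$ (1, 1), M $$ (1, 2)], [0, 0, c]]"
      using mat_3_eq[OF M[unfolded True]] by (simp only:)
    show ?thesis
    proof (cases "\<exists>a::'a. a \<noteq> 0 \<and> a \<noteq> 1")
      case True
      then obtain a :: 'a where "a \<noteq> 0" "a \<noteq> 1" by blast
      then show ?thesis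
        unfolding \<open>n = 3\<close> by (subst eq) (rule product_of_commutators_scalar_quotient_3[OF x])
    next
      case False
      then have F2: "t = 0 \<or> t = 1" for t :: 'a by blast
      then have "M $$ (0, 1) = 1" using x by blast
      then show ?thesis
        unfolding \<open>n = 3\<close> using product_of_commutators_scalar_quotient_F2[OF F2] by (subst eq) simp
    qed
  qed
qed

lemma product_of_commutators_nonscalar_quotient_cases:
  fixes M :: "'a::division_ring mat"
  assumes M: "M \<in> carrier_mat n n" and n: "n \<ge> 3"
    and M0: "\<And>i. i < n \<Longrightarrow> M $$ (i, 0) = (if i = n - 2 then 1 else 0)"
    and M1: "M $$ (n - 1, 1) \<noteq> 0"
  shows "product_of_commutators n M"
proof (cases "n = 3")
  case False
  define q where "q = n - 2"
  have nq: "n = 2 + q" and q: "q \<noteq> 1"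
    using n False by (auto simp: q_def)
  obtain R :: "'a mat" where R: "null_diagonals q R" "transpose_mat R * R = 1\<^sub>m q"
    using exists_orthogonal_null_diagonals[OF q] by blast
  note Rc = null_diagonals_carrier[OF R(1)]
  let ?P = "mat_of_rows_list 2 [[1, 0], [0, - 1]] :: 'a mat"
  let ?W = "four_block_mat ?P (0\<^sub>m 2 q) (0\<^sub>m q 2) R"
  let ?V = "four_block_mat ?P (0\<^sub>m 2 q) (0\<^sub>m q 2) (transpose_mat R)"
  have PP: "?P * ?P = 1\<^sub>m 2"
    unfolding mat_2_mult by (intro eq_matI) (auto simp: mat_of_rows_list_def less_Suc_eq numeral_2_eq_2)
  have dP: "dim_row ?P = 2" "dim_col ?P = 2"
    using carrier_matD[OF mat_2_carrier] by blast+
  \<comment> \<open>Here \<open>W\<close> is the sum of \<open>diag(1, -1)\<close> and a signed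
    permutation, with \<open>t = 1\<close>; for \<open>n = 3\<close> it will be
    \<open>diag(1, -a, a - 1)\<close> with \<open>t = a\<close>.\<close>
  show ?thesis
  proof (rule product_of_commutators_nonscalar_quotient[OF M n M0 M1, of ?W ?V 1])
    show "null_diagonals n ?W"
      unfolding nq by (intro null_diagonals_four_block null_diagonals_2 R(1)) simp_all
    show "?V \<in> carrier_mat n n"
      unfolding nq using Rc by (intro four_block_carrier_mat mat_2_carrier) simp
    show "?V * ?W = 1\<^sub>m n"
      unfolding nq using Rc mat_2_carrier R(2)
      by (subst mult_four_block_mat[of _ 2 2 _ q _ q _ _ 2 _ q])
        (simp_all add: PP left_mult_zero_mat[OF mat_2_carrier] right_mult_zero_mat[OF mat_2_carrier])
    fix i assume "i < n"
    then have "i < 2 + q" by (simp add: nq)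
    then consider "i = 0" | "i = 1" | "2 \<le> i" "i < 2 + q" by linarith
    then show "?W $$ (i, 0) = (if i = 0 then 1 else 0)" "?V $$ (i, 0) = (if i = 0 then 1 else 0)"
      "?V $$ (i, 1) = (if i = 1 then - inverse 1 else 0)"
      using Rc dP by (cases; simp add: mat_of_rows_list_def)+
  qed simp_all
next
  case True
  have Mc: "M \<in> carrier_mat 3 3" using M True by simp
  have i3: "i = 0 \<or> i = 1 \<or> i = 2" if "i < 3" for i :: nat
    using that by linarith
  show ?thesis
  proof (cases "\<exists>a::'a. a \<noteq> 0 \<and> a \<noteq> 1")
    case True
    then obtain a :: 'a where a: "a \<noteq> 0" "a \<noteq> 1" by blast
    let ?W = "mat_of_rows_list 3 [[1, 0, 0], [0, - a, 0], [0, 0, a - 1]]"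
    let ?V = "mat_of_rows_list 3 [[1, 0, 0], [0, - inverse a, 0], [0, 0, inverse (a - 1)]]"
    have "product_of_commutators 3 M"
    proof (rule product_of_commutators_nonscalar_quotient[OF Mc, of ?W ?V a])
      show "null_diagonals 3 ?W"
        by (rule null_diagonals_3) simp_all
      show "?V * ?W = 1\<^sub>m 3"
        using a by (simp add: mat_3_mult one_mat_3)
      fix i :: nat assume i: "i < 3"
      show "M $$ (i, 0) = (if i = 3 - 2 then 1 else 0)"
        using M0[of i] i \<open>n = 3\<close> by simp
      show "?W $$ (i, 0) = (if i = 0 then 1 else 0)" "?V $$ (i, 0) = (if i = 0 then 1 else 0)"
        "?V $$ (i, 1) = (if i = 1 then - inverse a else 0)"
        using i3[OF i] by (elim disjE; simp add: mat_3_index)+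
    qed (use M1 a \<open>n = 3\<close> mat_3_carrier in auto)
    then show ?thesis
      using \<open>n = 3\<close> by simp
  next
    case False
    then have F2: "t = 0 \<or> t = 1" for t :: 'a by blast
    have m: "M $$ (0, 0) = 0" "M $$ (1, 0) = 1" "M $$ (2, 0) = 0" "M $$ (2, 1) = 1"
      using M0[of 0] M0[of 1] M0[of 2] M1 F2[of "M $$ (2, 1)"] \<open>n = 3\<close> by (auto simp: numeral_2_eq_2)
    \<comment> \<open>Over two elements the image of the basis vector 1 has last entry 1, so it can
      replace the basis vector 2. The new basis consists of the vector 0 and its first two images,
      which gives a companion matrix.\<close>
    obtain N where N: "similar_mat N M" "N \<in> carrier_mat 3 3"
      "\<And>i j. i < 3 \<Longrightarrow> j < 2 \<Longrightarrow> N $$ (i, j) = (if i = 2 then M $$ (2, j) else M $$ (i, j) - M $$ (i, 1) * M $$ (2, j))"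
      by (rule similar_replace_column[of M 3 2 "\<lambda>i. M $$ (i, 1)", OF Mc]) (use m in auto)
    have "N $$ (0, 0) = 0" "N $$ (1, 0) = 1" "N $$ (2, 0) = 0" "N $$ (0, 1) = 0" "N $$ (1, 1) = 0" "N $$ (2, 1) = 1"
      using N(3) m by auto
    then have "N = mat_of_rows_list 3 [[0, 0, N $$ (0, 2)], [1, 0, N $$ (1, 2)], [0, 1, N $$ (2, 2)]]"
      using mat_3_eq[OF N(2)] by (simp only:)
    then have "product_of_commutators 3 N"
      using product_of_commutators_companion_F2[OF F2] by (rule ssubst)
    then show ?thesis
      using N(1) product_of_commutators_similar similar_mat_sym \<open>n = 3\<close> by blast
  qed
qed

lemma product_of_commutators_mat:
  fixes M :: "'a::division_ring mat"
  assumes M: "M \<in> carrier_mat n n" and n: "n \<ge> 2"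
  shows "product_of_commutators n M"
proof -
  \<comment> \<open>The first column is to become the unit vector \<open>k\<close>; for
    \<open>n = 2\<close> the index \<open>n - 2\<close> would be 0, so 1 is used.\<close>
  define k where "k = (if n = 2 then 1 else n - 2)"
  have k: "0 < k" "k < n"
    using n by (auto simp: k_def)
  consider c where "M = c \<cdot>\<^sub>m 1\<^sub>m n"
    | N where "similar_mat N M" "N \<in> carrier_mat n n" "\<And>i. i < n \<Longrightarrow> N $$ (i, 0) = (if i = k then 1 else 0)"
    using unit_first_column_or_scalar[OF M k] by blast
  then show ?thesis
  proof cases
    case (1 c)
    have "n \<noteq> 1" using n by simp
    then show ?thesis
      unfolding 1 by (rule product_of_commutators_scalar)
  next
    case (2 N)
    have "product_of_commutators n N"
    proof (cases "n = 2")
      case True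
      then show ?thesis
        using 2 by (intro product_of_commutators_scalar_quotient_cases) (auto simp: k_def)
    next
      case False
      then have n3: "n \<ge> 3" and k: "k = n - 2"
        using n by (auto simp: k_def)
      show ?thesis
      proof (rule nonscalar_or_scalar_quotient[OF 2(2) n3 2(3)[unfolded k]])
        fix N' assume "similar_mat N' N" "N' \<in> carrier_mat n n"
          "\<And>i. i < n \<Longrightarrow> N' $$ (i, 0) = (if i = n - 2 then 1 else 0)" "N' $$ (n - 1, 1) \<noteq> 0"
        then show ?thesis
          using product_of_commutators_nonscalar_quotient_cases[OF _ n3] product_of_commutators_similar similar_mat_sym by blast
      next
        fix c assume c: "\<And>i j. i < n \<Longrightarrow> j < n \<Longrightarrow> i \<noteq> 0 \<Longrightarrow> i \<noteq> n - 2 \<Longrightarrow> j \<noteq> 0 \<Longrightarrow> N $$ (i, j) = (if i = j then c else 0)"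
        \<comment> \<open>The swap makes 0 and 1 the indices of the plane, so that \<open>?N\<close>
          becomes block triangular.\<close>
        let ?\<pi> = "transpose 1 (n - 2)"
        let ?N = "mat n n (\<lambda>(i, j). N $$ (?\<pi> i, ?\<pi> j))"
        have "?\<pi> permutes {..<n}"
          using n3 by (intro permutes_swap_id) auto
        then have "similar_mat N ?N"
          using similar_mat_permute[OF 2(2)] similar_mat_sym by blast
        moreover have "product_of_commutators n ?N"
        proof (rule product_of_commutators_scalar_quotient_cases[of _ _ c])
          show "?N $$ (i, 0) = (if i = 1 then 1 else 0)" if "i < n" for i
            using that n3 2(3) by (auto simp: k transpose_def)
          show "?N $$ (i, j) = (if i = j then c else 0)" if "2 \<le> i" "i < n" "j < n" for i j
          proof (cases "j = 0")
            case True
            then show ?thesis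
              using that n3 2(3) by (auto simp: k transpose_def)
          next
            case False
            then show ?thesis
              using that n3 c by (auto simp: transpose_def)
          qed
        qed (use n in auto)
        ultimately show ?thesis
          using product_of_commutators_similar by blast
      qed
    qed
    then show ?thesis
      using 2(1) product_of_commutators_similar similar_mat_sym by blast
  qed
qed

theorem theorem30:
  fixes M :: "'a::division_ring mat" and n :: nat
  assumes "\<forall>a::'a. algebraic_over_center a"
    and "n \<ge> 2"
    and "M \<in> carrier_mat n n"
  shows "\<exists>C \<in> commutators_mat n. \<exists>D \<in> commutators_mat n. M = C * D"
  using product_of_commutators_mat[OF assms(3,2)] unfolding product_of_commutators_def .

end
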